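(* Let $k,\ell,n\geqslant 0$ be integers and let $\Lambda_n^{k,\ell}=\sum_{\alpha\in \mathsf{P}(n)} s_{k,\ell}(\alpha)\chi_\alpha$, a character of the symmetric group $\mathfrak{S}_n$, where $s_{k,\ell}(\alpha)$ is the number of semistandard $(k,\ell)$-tableaux of shape $\alpha$. If $\nu=(\nu_1,\dots,\nu_r)$ is a partition of $n$ of length $r$ (so $\nu_1\geqslant\cdots\geqslant\nu_r>0$ and $\nu_1+\cdots+\nu_r=n$), then $$\Lambda_n^{k,\ell}(\nu)=\prod_{i=1}^r\bigl(k+(-1)^{\nu_i-1}\ell\bigr),$$ where $\Lambda_n^{k,\ell}(\nu)$ denotes the value of $\Lambda_n^{k,\ell}$ at an element of $\mathfrak{S}_n$ of cycle type $\nu$.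
   Context: $\mathbb{N}=\{1,2,\dots\}$ and $\mathsf{P}(n)$ is the set of all partitions of $n$, with $\mathsf{P}(0)$ consisting of the empty partition (of length $0$). For $\alpha\in\mathsf{P}(n)$, $\chi_\alpha$ is the corresponding irreducible complex character of $\mathfrak{S}_n$, with the standard labelling of Macdonald (the Frobenius characteristic of $\chi_\alpha$ is the Schur function $s_\alpha$; in particular $\chi_{(n)}$ is the trivial character and $\chi_{(1^n)}$ is the sign character). The Young diagram of $\alpha$ is $T_\alpha=\{(i,j)\in\mathbb{N}^2\mid 1\leqslant j\leqslant\alpha_i\}$, where $i$ indexes rows and $j$ indexes columns. Let $D=\{1,\dots,k,1',\dots,\ell'\}$ be totally ordered by $1<\cdots<k<1'<\cdots<\ell'$. A $(k,\ell)$-tableau of shape $\alpha$ is a function $f:T_\alpha\to D$. It is semistandard if $T_f:=f^{-1}(\{1,\dots,k\})$ is the Young diagram of a partition (possibly empty), the entries of $f$ on $T_f$ are weakly increasing along rows and strictly increasing down columns, and the entries of $f$ on the skew diagram $T_\alpha\setminus T_f$ are weakly increasing down columns and strictly increasing along rows. The number of all semistandard $(k,\ell)$-tableaux of shape $\alpha$ is $s_{k,\ell}(\alpha)$. *)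

theory Defs
  imports
    "HOL-Library.FuncSet"
    "HOL-Library.Multiset"
    "HOL-Combinatorics.Orbits"
    "HOL-Algebra.Sym_Groups"
    "Jordan_Normal_Form.VS_Connect"
begin

section \<open>Partitions and Young diagrams\<close>

text \<open>The list index starts at 0, so the part $\alpha_i$ is \<open>\<alpha> ! (i - 1)\<close>.\<close>

definition partitions_of :: "nat \<Rightarrow> nat list set" where
  "partitions_of n = {\<alpha>. sorted_wrt (\<ge>) \<alpha> \<and> 0 \<notin> set \<alpha> \<and> sum_list \<alpha> = n}"

definition young_diagram :: "nat list \<Rightarrow> (nat \<times> nat) set" where
  "young_diagram \<alpha> = {(i, j). 1 \<le> i \<and> i \<le> length \<alpha> \<and> 1 \<le> j \<and> j \<le> \<alpha> ! (i - 1)}"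

definition along_rows ::
  "(nat \<Rightarrow> nat \<Rightarrow> bool) \<Rightarrow> (nat \<times> nat) set \<Rightarrow> (nat \<times> nat \<Rightarrow> nat) \<Rightarrow> bool" where
  "along_rows R S f \<longleftrightarrow>
     (\<forall>i j j'. (i, j) \<in> S \<and> (i, j') \<in> S \<and> j < j' \<longrightarrow> R (f (i, j)) (f (i, j')))"

definition down_columns ::
  "(nat \<Rightarrow> nat \<Rightarrow> bool) \<Rightarrow> (nat \<times> nat) set \<Rightarrow> (nat \<times> nat \<Rightarrow> nat) \<Rightarrow> bool" where
  "down_columns R S f \<longleftrightarrow>
     (\<forall>i i' j. (i, j) \<in> S \<and> (i', j) \<in> S \<and> i < i' \<longrightarrow> R (f (i, j)) (f (i', j)))"

section \<open>Semistandard \<open>(k,l)\<close>-tableaux\<close>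

text \<open>The ordered alphabet $1 < \dots < k < 1' < \dots < \ell'$ is encoded as \<open>{1..k+l}\<close>, with $j'$
  represented by \<open>k + j\<close>. Tableaux are extensional functions (\<open>undefined\<close> off the diagram), so that
  counting them counts functions on the diagram.\<close>

definition semistandard_tableaux ::
  "nat \<Rightarrow> nat \<Rightarrow> nat list \<Rightarrow> (nat \<times> nat \<Rightarrow> nat) set" where
  "semistandard_tableaux k l \<alpha> =
     {f \<in> young_diagram \<alpha> \<rightarrow>\<^sub>E {1..k+l}.
        let T = {c \<in> young_diagram \<alpha>. f c \<in> {1..k}}; S = young_diagram \<alpha> - T in
        (\<exists>m. \<exists>\<mu> \<in> partitions_of m. T = young_diagram \<mu>) \<and>
        along_rows (\<le>) T f \<and> down_columns (<) T f \<and>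
        down_columns (\<le>) S f \<and> along_rows (<) S f}"

definition num_tableaux :: "nat \<Rightarrow> nat \<Rightarrow> nat list \<Rightarrow> nat" where
  "num_tableaux k l \<alpha> = card (semistandard_tableaux k l \<alpha>)"

section \<open>Complex characters of a group\<close>

text \<open>A representation of degree \<open>d\<close> is a homomorphism into $GL_d(\mathbb{C})$. Degree 0 is allowed, so
  that the zero function is a character (needed for $\Lambda_n^{0,0}$ with $n > 0$), but a representation
  of degree 0 is not irreducible.\<close>

definition representation :: "('g, 'b) monoid_scheme \<Rightarrow> nat \<Rightarrow> ('g \<Rightarrow> complex mat) \<Rightarrow> bool" where
  "representation G d \<rho> \<longleftrightarrow> \<rho> \<in> hom G (units_of (ring_mat TYPE(complex) d ()))"

definition irreducible_representation ::
  "('g, 'b) monoid_scheme \<Rightarrow> nat \<Rightarrow> ('g \<Rightarrow> complex mat) \<Rightarrow> bool" where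
  "irreducible_representation G d \<rho> \<longleftrightarrow>
     representation G d \<rho> \<and> d > 0 \<and>
     (\<forall>W. VectorSpace.subspace class_ring W (module_vec TYPE(complex) d) \<and>
          (\<forall>g \<in> carrier G. \<forall>w \<in> W. \<rho> g *\<^sub>v w \<in> W) \<longrightarrow>
          W = {0\<^sub>v d} \<or> W = carrier_vec d)"

definition affords ::
  "('g, 'b) monoid_scheme \<Rightarrow> nat \<Rightarrow> ('g \<Rightarrow> complex mat) \<Rightarrow> ('g \<Rightarrow> complex) \<Rightarrow> bool" where
  "affords G d \<rho> \<chi> \<longleftrightarrow> (\<forall>g \<in> carrier G. \<chi> g = (\<Sum>i<d. \<rho> g $$ (i, i)))"

definition is_character :: "('g, 'b) monoid_scheme \<Rightarrow> ('g \<Rightarrow> complex) \<Rightarrow> bool" where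
  "is_character G \<chi> \<longleftrightarrow> (\<exists>d \<rho>. representation G d \<rho> \<and> affords G d \<rho> \<chi>)"

definition is_irreducible_character :: "('g, 'b) monoid_scheme \<Rightarrow> ('g \<Rightarrow> complex) \<Rightarrow> bool" where
  "is_irreducible_character G \<chi> \<longleftrightarrow>
     (\<exists>d \<rho>. irreducible_representation G d \<rho> \<and> affords G d \<rho> \<chi>)"

section \<open>Symmetric functions and the labelling of the irreducible characters\<close>

text \<open>A symmetric function with complex coefficients is represented by its values \<open>F N x\<close> at
  $(x_1,\dots,x_N,0,0,\dots)$, for all \<open>N\<close> and all complex $x_1,\dots,x_N$. As a polynomial over an infinite
  field is determined by its values, two symmetric functions are equal if and only if these values
  agree.\<close>

type_synonym symfun = "nat \<Rightarrow> (nat \<Rightarrow> complex) \<Rightarrow> complex"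

definition power_sum :: "nat list \<Rightarrow> symfun" where
  "power_sum \<nu> N x = (\<Prod>r\<leftarrow>\<nu>. \<Sum>j=1..N. x j ^ r)"

definition ordinary_tableaux :: "nat \<Rightarrow> nat list \<Rightarrow> (nat \<times> nat \<Rightarrow> nat) set" where
  "ordinary_tableaux N \<alpha> =
     {f \<in> young_diagram \<alpha> \<rightarrow>\<^sub>E {1..N}.
        along_rows (\<le>) (young_diagram \<alpha>) f \<and> down_columns (<) (young_diagram \<alpha>) f}"

definition schur_function :: "nat list \<Rightarrow> symfun" where
  "schur_function \<alpha> N x = (\<Sum>f \<in> ordinary_tableaux N \<alpha>. \<Prod>c \<in> young_diagram \<alpha>. x (f c))"

text \<open>The orbits include the fixed points, which contribute parts equal to 1.\<close>

definition cycle_type :: "nat \<Rightarrow> (nat \<Rightarrow> nat) \<Rightarrow> nat list" where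
  "cycle_type n \<sigma> =
     rev (sorted_list_of_multiset (image_mset card (mset_set (orbit \<sigma> ` {1..n}))))"

definition frobenius_characteristic :: "nat \<Rightarrow> ((nat \<Rightarrow> nat) \<Rightarrow> complex) \<Rightarrow> symfun" where
  "frobenius_characteristic n \<phi> N x =
     (\<Sum>\<sigma> \<in> carrier (sym_group n). \<phi> \<sigma> * power_sum (cycle_type n \<sigma>) N x) / fact n"

text \<open>The Frobenius characteristic is injective on class functions, so on $\mathfrak{S}_n$ the following
  predicate determines $\chi_\alpha$ uniquely.\<close>

definition is_irreducible_character_of_label ::
  "nat \<Rightarrow> nat list \<Rightarrow> ((nat \<Rightarrow> nat) \<Rightarrow> complex) \<Rightarrow> bool" where
  "is_irreducible_character_of_label n \<alpha> \<phi> \<longleftrightarrow>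
     is_irreducible_character (sym_group n) \<phi> \<and>
     frobenius_characteristic n \<phi> = schur_function \<alpha>"

definition Lambda_char ::
  "(nat list \<Rightarrow> (nat \<Rightarrow> nat) \<Rightarrow> complex) \<Rightarrow> nat \<Rightarrow> nat \<Rightarrow> nat \<Rightarrow> (nat \<Rightarrow> nat) \<Rightarrow> complex" where
  "Lambda_char \<chi> k l n \<sigma> = (\<Sum>\<alpha> \<in> partitions_of n. of_nat (num_tableaux k l \<alpha>) * \<chi> \<alpha> \<sigma>)"

end

theory Submission
  imports Defs "Jordan_Normal_Form.Spectral_Radius" "Jordan_Normal_Form.Matrix_Kernel"
begin

text \<open>Write $\chi_\alpha(\nu)$ for the value at cycle type $\nu$, and put
  $q_\nu = \prod_i (k - (-1)^{\nu_i} \ell)$. By hypothesis $s_\alpha$ is the average of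
  $\chi_\alpha(\sigma) p_{\mathrm{cyc}(\sigma)}$ over $\mathfrak{S}_n$. The first step is that replacing
  every $p_r$ by $k - (-1)^r \ell$ turns $s_\alpha$ into $s_{k,\ell}(\alpha)$. At
  $x = (1^k, (-1)^m)$ the power sum $p_r$ is $k + (-1)^r m$, so the right-hand side is a polynomial in
  $m$, and one wants its value at $m = -\ell$. On the tableau side, passing from $m$ to $m + 1$ applies
  the operator that removes a horizontal strip with sign; this operator is unipotent, hence its powers
  are polynomial in the exponent, and its inverse removes a vertical strip. Thus the value at $-\ell$
  counts tableaux with $\ell$ additional row-strict letters.

  Secondly, the $\chi_\alpha$ are pairwise distinct because the degree of
  $s_\alpha(t, \dots, t, 1, \dots, 1)$ with $p$ variables equal to $t$ is
  $\alpha_1 + \dots + \alpha_p$. By Schur's lemma they are orthonormal, and there are as many of them as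
  partitions, so the character table is an invertible square matrix. Inverting the expansion of
  $s_{k,\ell}(\alpha)$ in the $q_\nu$ gives the value of $\Lambda_n^{k,\ell}$.\<close>

section \<open>Diagrams and strips\<close>

text \<open>One more variable equal to -1 adds \<open>(- 1) ^ r\<close> to the power sum of degree
  r, so a primed letter, which should subtract it, acts as the formal inverse of such a variable. A
  negative number of variables has no direct meaning as a sum over tableaux, so the proof works with
  functions w on all diagrams at once. Read w as the linear functional that sends the Schur function
  of L to w(L). By Pieri's rule, \<open>hstep t\<close> composes this functional with skewing by the
  sum of all t^i h_i, and \<open>vstep\<close> with skewing by the sum of all e_i. That
  \<open>hstep (- 1)\<close> undoes \<open>vstep\<close> is then the identity H(-1) E(1) = 1 between
  the generating series of complete and elementary symmetric functions, proved here by a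
  sign-reversing involution. Extending the sequence to negative m by tableau counts makes one
  recurrence valid on all integers, which carries polynomiality across 0. On the character side a
  permutation and its inverse have the same cycle type. Orthogonality therefore becomes a bilinear
  relation between values, and the inverse of the character table is explicit: class size times
  value, divided by n!.\<close>

definition diagram :: "(nat \<times> nat) set \<Rightarrow> bool" where
  "diagram D \<longleftrightarrow> finite D \<and> (\<forall>i j. (i, j) \<in> D \<longrightarrow> 1 \<le> i \<and> 1 \<le> j \<and> {1..i} \<times> {1..j} \<subseteq> D)"

text \<open>Cells are (row, column), so injectivity of \<open>snd\<close> allows at most one removed
  cell per column: \<open>D - L\<close> is a horizontal strip. With \<open>fst\<close> it is a
  vertical strip.\<close>

definition horizontal_removals :: "(nat \<times> nat) set \<Rightarrow> (nat \<times> nat) set set" where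
  "horizontal_removals D = {L. diagram L \<and> L \<subseteq> D \<and> inj_on snd (D - L)}"

definition vertical_removals :: "(nat \<times> nat) set \<Rightarrow> (nat \<times> nat) set set" where
  "vertical_removals D = {L. diagram L \<and> L \<subseteq> D \<and> inj_on fst (D - L)}"

definition hstep :: "complex \<Rightarrow> ((nat \<times> nat) set \<Rightarrow> complex) \<Rightarrow> (nat \<times> nat) set \<Rightarrow> complex" where
  "hstep t w D = (\<Sum>L\<in>horizontal_removals D. t ^ card (D - L) * w L)"

definition vstep :: "((nat \<times> nat) set \<Rightarrow> complex) \<Rightarrow> (nat \<times> nat) set \<Rightarrow> complex" where
  "vstep w D = (\<Sum>L\<in>vertical_removals D. w L)"

lemma diagram_finite: "diagram D \<Longrightarrow> finite D"
  by (simp add: diagram_def)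

lemma diagram_pos: "diagram D \<Longrightarrow> (i, j) \<in> D \<Longrightarrow> 1 \<le> i \<and> 1 \<le> j"
  by (auto simp: diagram_def)

lemma diagram_down:
  assumes "diagram D" "(i, j) \<in> D" "1 \<le> i'" "i' \<le> i" "1 \<le> j'" "j' \<le> j"
  shows "(i', j') \<in> D"
proof -
  have "{1..i} \<times> {1..j} \<subseteq> D" using assms(1,2) unfolding diagram_def by blast
  moreover have "(i', j') \<in> {1..i} \<times> {1..j}" using assms by simp
  ultimately show ?thesis by (rule subsetD)
qed

lemma diagramI:
  assumes "finite D" "\<And>i j. (i, j) \<in> D \<Longrightarrow> 1 \<le> i \<and> 1 \<le> j"
    "\<And>i j i' j'. (i, j) \<in> D \<Longrightarrow> 1 \<le> i' \<Longrightarrow> i' \<le> i \<Longrightarrow> 1 \<le> j' \<Longrightarrow> j' \<le> j \<Longrightarrow> (i', j') \<in> D"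
  shows "diagram D"
proof -
  have "{1..i} \<times> {1..j} \<subseteq> D" if "(i, j) \<in> D" for i j
    using assms(3)[OF that] by (intro subsetI) (metis SigmaE atLeastAtMost_iff)
  then show ?thesis using assms(1,2) unfolding diagram_def by blast
qed

lemma finite_horizontal_removals: "finite D \<Longrightarrow> finite (horizontal_removals D)"
  unfolding horizontal_removals_def by (rule finite_subset[of _ "Pow D"]) auto

lemma self_horizontal_removal: "diagram D \<Longrightarrow> D \<in> horizontal_removals D"
  by (simp add: horizontal_removals_def)

text \<open>The terms cancel in pairs that differ by the leftmost cell of the lowest row of \<open>D - M\<close>: this cell
  may always be moved between the vertical strip \<open>L - M\<close> and the horizontal strip \<open>D - L\<close>.\<close>

lemma strips_sum_zero:
  assumes D: "diagram D" and M: "diagram M" "M \<subset> D"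
  shows "(\<Sum>L | L \<in> horizontal_removals D \<and> M \<in> vertical_removals L. (- 1 :: complex) ^ card (D - L)) = 0"
proof -
  define A where "A = {L. L \<in> horizontal_removals D \<and> M \<in> vertical_removals L}"
  have finD: "finite D" using D by (rule diagram_finite)
  define r where "r = Max (fst ` (D - M))"
  have "r \<in> fst ` (D - M)" unfolding r_def using M finD by (intro Max_in) auto
  have rmax: "i \<le> r" if "(i, j) \<in> D - M" for i j
    unfolding r_def using that finD by (intro Max_ge) force+
  define q where "q = (LEAST j. (r, j) \<in> D - M)"
  obtain j0 where "(r, j0) \<in> D - M" using \<open>r \<in> fst ` (D - M)\<close> by auto
  then have c: "(r, q) \<in> D - M" unfolding q_def by (rule LeastI)
  have qmin: "q \<le> j" if "(r, j) \<in> D - M" for j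
    unfolding q_def using that by (rule Least_le)
  have inM: "(i, j) \<in> M" if "(i, j) \<in> D" "i > r \<or> i = r \<and> j < q" for i j
    using that rmax[of i j] qmin[of j] by force
  have pos: "1 \<le> r" "1 \<le> q" using diagram_pos[OF D] c by auto
  define tog where "tog L = (if (r, q) \<in> L then L - {(r, q)} else insert (r, q) L)" for L
  have AE: "L \<in> A \<longleftrightarrow> diagram L \<and> M \<subseteq> L \<and> L \<subseteq> D \<and> inj_on snd (D - L) \<and> inj_on fst (L - M)" for L
    using M by (auto simp: A_def horizontal_removals_def vertical_removals_def)
  have ins: "insert (r, q) L \<in> A" if L: "L \<in> A" "(r, q) \<notin> L" for L
  proof -
    have L': "diagram L" "M \<subseteq> L" "L \<subseteq> D" "inj_on snd (D - L)" "inj_on fst (L - M)" using L(1) unfolding AE by blast+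
    have "diagram (insert (r, q) L)"
    proof (rule diagramI)
      show "finite (insert (r, q) L)" using diagram_finite[OF L'(1)] by blast
      show "1 \<le> i \<and> 1 \<le> j" if "(i, j) \<in> insert (r, q) L" for i j
        using that pos diagram_pos[OF L'(1)] by auto
      fix i j i' j' assume ij: "(i, j) \<in> insert (r, q) L" "1 \<le> i'" "i' \<le> i" "1 \<le> j'" "j' \<le> j"
      show "(i', j') \<in> insert (r, q) L"
      proof (cases "(i, j) \<in> L")
        case True then show ?thesis using diagram_down[OF L'(1)] ij by blast
      next
        case False
        then have ij': "i = r" "j = q" using ij by auto
        have inD: "(i', j') \<in> D" "(r, j') \<in> D" using diagram_down[OF D, of r q] c ij ij' by auto
        show ?thesis
        proof (cases "j' < q")
          case True
          then have "(r, j') \<in> L" using inM inD L' by blast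
          then show ?thesis using diagram_down[OF L'(1)] ij ij' by blast
        next
          case False
          then have "j' = q" using ij ij' by auto
          \<comment> \<open>\<open>D - L\<close> already contains (r, q) and has at most one cell in
            column q, so every cell of D above (r, q) lies in L.\<close>
          then have "(i', j') \<in> L \<or> i' = r"
            using L'(4) inD L(2) c unfolding inj_on_def by (metis DiffI DiffD1 fst_conv snd_conv)
          then show ?thesis using \<open>j' = q\<close> by auto
        qed
      qed
    qed
    moreover have "inj_on snd (D - insert (r, q) L)"
      using L'(4) by (rule inj_on_subset) auto
    moreover have "inj_on fst (insert (r, q) L - M)"
    proof -
      \<comment> \<open>A cell of \<open>L - M\<close> in row r would lie weakly right of (r, q),
        and the diagram L would then contain (r, q).\<close>
      have nin: "(r, j) \<notin> L - M" for j
      proof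
        assume that: "(r, j) \<in> L - M"
        then have "q \<le> j" using L' qmin by blast
        then have "(r, q) \<in> L" using diagram_down[OF L'(1), of r j r q] that pos by auto
        then show False using L by blast
      qed
      have "insert (r, q) L - M = insert (r, q) (L - M)" using c by blast
      then show ?thesis using L'(5) nin by (auto simp: inj_on_insert)
    qed
    ultimately show ?thesis using L'(2,3) c unfolding AE by blast
  qed
  have del: "L - {(r, q)} \<in> A" if L: "L \<in> A" "(r, q) \<in> L" for L
  proof -
    have L': "diagram L" "M \<subseteq> L" "L \<subseteq> D" "inj_on snd (D - L)" "inj_on fst (L - M)" using L(1) unfolding AE by blast+
    have "diagram (L - {(r, q)})"
    proof (rule diagramI)
      show "finite (L - {(r, q)})" using diagram_finite[OF L'(1)] by blast
      show "1 \<le> i \<and> 1 \<le> j" if "(i, j) \<in> L - {(r, q)}" for i j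
        using that diagram_pos[OF L'(1)] by blast
      fix i j i' j' assume ij: "(i, j) \<in> L - {(r, q)}" "1 \<le> i'" "i' \<le> i" "1 \<le> j'" "j' \<le> j"
      have "(i', j') \<in> L" using diagram_down[OF L'(1)] ij by blast
      moreover have "(i', j') \<noteq> (r, q)"
      proof
        assume e: "(i', j') = (r, q)"
        \<comment> \<open>A cell (i, j) of L weakly below and right of (r, q) is outside M because M
          is a diagram. Maximality of r puts it in row r, and \<open>L - M\<close> has only one cell
          there.\<close>
        have "(i, j) \<notin> M" using diagram_down[OF M(1), of i j r q] e ij c by auto
        then have "i = r" using rmax[of i j] ij e L' by auto
        then have "(i, j) = (r, q)" using inj_onD[OF L'(5), of "(i, j)" "(r, q)"] L(2) \<open>(i, j) \<notin> M\<close> ij c by auto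
        then show False using ij by auto
      qed
      ultimately show "(i', j') \<in> L - {(r, q)}" by auto
    qed
    moreover have "inj_on fst (L - {(r, q)} - M)"
      using L'(5) by (rule inj_on_subset) auto
    moreover have "inj_on snd (D - (L - {(r, q)}))"
    proof -
      \<comment> \<open>As M is contained in L, maximality of r puts such a cell weakly above (r,
        q), so it would belong to the diagram L.\<close>
      have nin: "(i, q) \<notin> D - L" for i
      proof
        assume that: "(i, q) \<in> D - L"
        then have "i \<le> r" using L' rmax by blast
        then have "(i, q) \<in> L" using diagram_down[OF L'(1), of r q i q] diagram_pos[OF D, of i q] that L pos by auto
        then show False using that by blast
      qed
      have "D - (L - {(r, q)}) = insert (r, q) (D - L)" using c by blast
      then show ?thesis using L'(4) nin by (auto simp: inj_on_insert)
    qed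
    ultimately show ?thesis using L'(2,3) c unfolding AE by blast
  qed
  have togA: "tog L \<in> A" if "L \<in> A" for L using ins del that by (auto simp: tog_def)
  have togtog: "tog (tog L) = L" for L by (auto simp: tog_def)
  have sgn: "(-1 :: complex) ^ card (D - tog L) = - ((-1) ^ card (D - L))" if "L \<in> A" for L
  proof (cases "(r, q) \<in> L")
    case True
    then have "D - tog L = insert (r, q) (D - L)" using c by (auto simp: tog_def)
    then show ?thesis using True finD by simp
  next
    case False
    then have "D - L = insert (r, q) (D - tog L)" "(r, q) \<notin> D - tog L" using c by (auto simp: tog_def)
    then have "card (D - L) = Suc (card (D - tog L))" using finD by simp
    then show ?thesis by simp
  qed
  have "(\<Sum>L\<in>A. (-1 :: complex) ^ card (D - L)) = (\<Sum>L\<in>A. - ((-1) ^ card (D - L)))"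
    by (rule sum.reindex_bij_witness[of _ tog tog]) (use togA togtog sgn in auto)
  then have "(\<Sum>L\<in>A. (-1 :: complex) ^ card (D - L)) = 0" by (simp add: sum_negf)
  then show ?thesis by (simp add: A_def)
qed

text \<open>Exchanging the two sums gives each \<open>w M\<close> an alternating sum over the
  intermediate diagrams L as coefficient. It vanishes by \<open>strips_sum_zero\<close> unless M =
  D, where L = D is the only term.\<close>

lemma hstep_vstep:
  assumes D: "diagram D"
  shows "hstep (-1) (vstep w) D = w D"
proof -
  have finD: "finite D" using D by (rule diagram_finite)
  let ?S = "{M. diagram M \<and> M \<subseteq> D}"
  have finS: "finite ?S" by (rule finite_subset[of _ "Pow D"]) (use finD in auto)
  have "hstep (-1) (vstep w) D
      = (\<Sum>L\<in>horizontal_removals D. \<Sum>M | M \<in> ?S \<and> M \<in> vertical_removals L. (-1) ^ card (D - L) * w M)"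
    unfolding hstep_def vstep_def sum_distrib_left
    by (intro sum.cong refl) (auto simp: horizontal_removals_def vertical_removals_def)
  also have "\<dots> = (\<Sum>M\<in>?S. \<Sum>L | L \<in> horizontal_removals D \<and> M \<in> vertical_removals L. (-1) ^ card (D - L) * w M)"
    using finS finite_horizontal_removals[OF finD] by (intro sum.swap_restrict)
  also have "\<dots> = (\<Sum>M\<in>?S. if M = D then w D else 0)"
  proof (intro sum.cong refl)
    fix M assume M: "M \<in> ?S"
    show "(\<Sum>L | L \<in> horizontal_removals D \<and> M \<in> vertical_removals L. (-1) ^ card (D - L) * w M)
        = (if M = D then w D else 0)"
    proof (cases "M = D")
      case True
      have "{L. L \<in> horizontal_removals D \<and> D \<in> vertical_removals L} = {D}"
        using D by (auto simp: horizontal_removals_def vertical_removals_def)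
      then show ?thesis using True by simp
    next
      case False
      then show ?thesis
        using strips_sum_zero[OF D, of M] M by (auto simp flip: sum_distrib_right)
    qed
  qed
  also have "\<dots> = w D" using D finS by simp
  finally show ?thesis .
qed

section \<open>Removing the largest letter of a tableau\<close>

text \<open>The value \<open>undefined\<close> off D keeps the result extensional, so that filling
  is a genuine inverse of restricting to the smaller letters.\<close>

definition fill :: "nat \<Rightarrow> (nat \<times> nat) set \<Rightarrow> (nat \<times> nat) set \<Rightarrow> (nat \<times> nat \<Rightarrow> nat) \<Rightarrow> nat \<times> nat \<Rightarrow> nat" where
  "fill N L D g = (\<lambda>c. if c \<in> L then g c else if c \<in> D then Suc N else undefined)"

text \<open>Shared bookkeeping for ordinary and super tableaux: f corresponds to the pair of its
  cells with letters at most N and its restriction to them. The summand h is arbitrary because the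
  lemma serves both monomial weights and plain counting.\<close>

lemma sum_remove_largest_letter:
  assumes finD: "finite D"
    and X: "X \<subseteq> D \<rightarrow>\<^sub>E {1..Suc N}"
    and R: "\<And>L. L \<in> R \<Longrightarrow> L \<subseteq> D"
    and Y: "\<And>L. L \<in> R \<Longrightarrow> Y L \<subseteq> L \<rightarrow>\<^sub>E {1..N}"
    and restr: "\<And>f. f \<in> X \<Longrightarrow> {c \<in> D. f c \<le> N} \<in> R \<and> restrict f {c \<in> D. f c \<le> N} \<in> Y {c \<in> D. f c \<le> N}"
    and ext: "\<And>L g. L \<in> R \<Longrightarrow> g \<in> Y L \<Longrightarrow> fill N L D g \<in> X"
  shows "sum h X = (\<Sum>L\<in>R. \<Sum>g\<in>Y L. h (fill N L D g))"
proof -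
  have "finite R" by (rule finite_subset[of _ "Pow D"]) (use R finD in auto)
  moreover have "finite (Y L)" if "L \<in> R" for L
    by (rule finite_subset[OF Y[OF that]]) (use R[OF that] finD finite_subset in \<open>auto intro!: finite_PiE\<close>)
  ultimately have "(\<Sum>L\<in>R. \<Sum>g\<in>Y L. h (fill N L D g)) = (\<Sum>(L, g)\<in>Sigma R Y. h (fill N L D g))"
    by (intro sum.Sigma) auto
  also have "\<dots> = sum h X"
  proof (rule sum.reindex_bij_witness[of _ "\<lambda>f. ({c \<in> D. f c \<le> N}, restrict f {c \<in> D. f c \<le> N})" "\<lambda>(L, g). fill N L D g"])
    fix a assume a: "a \<in> Sigma R Y"
    obtain L g where [simp]: "a = (L, g)" by force
    have L: "L \<in> R" "g \<in> Y L" "L \<subseteq> D" using a R by auto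
    then have g: "g \<in> L \<rightarrow>\<^sub>E {1..N}" using Y by auto
    have "{c \<in> D. fill N L D g c \<le> N} = L" using g L unfolding fill_def by auto
    moreover have "restrict (fill N L D g) L = g"
    proof
      show "restrict (fill N L D g) L c = g c" for c
        by (cases "c \<in> L") (simp_all add: fill_def PiE_arb[OF g])
    qed
    ultimately show "({c \<in> D. (case a of (L, g) \<Rightarrow> fill N L D g) c \<le> N}, restrict (case a of (L, g) \<Rightarrow> fill N L D g) {c \<in> D. (case a of (L, g) \<Rightarrow> fill N L D g) c \<le> N}) = a"
      by simp
    show "(case a of (L, g) \<Rightarrow> fill N L D g) \<in> X" using ext L by simp
  next
    fix f assume f: "f \<in> X"
    then have f': "f \<in> D \<rightarrow>\<^sub>E {1..Suc N}" using X by auto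
    show "(case ({c \<in> D. f c \<le> N}, restrict f {c \<in> D. f c \<le> N}) of (L, g) \<Rightarrow> fill N L D g) = f"
    proof
      fix c
      show "(case ({c \<in> D. f c \<le> N}, restrict f {c \<in> D. f c \<le> N}) of (L, g) \<Rightarrow> fill N L D g) c = f c"
      proof (cases "c \<in> D")
        case True
        then have "f c \<le> Suc N" using f' by auto
        then show ?thesis using True by (auto simp: fill_def le_Suc_eq)
      next
        case False
        then show ?thesis by (simp add: fill_def PiE_arb[OF f'])
      qed
    qed
    show "({c \<in> D. f c \<le> N}, restrict f {c \<in> D. f c \<le> N}) \<in> Sigma R Y" using restr[OF f] by auto
  qed auto
  finally show ?thesis by simp
qed

definition column_strict :: "nat \<Rightarrow> (nat \<times> nat) set \<Rightarrow> (nat \<times> nat \<Rightarrow> nat) set" where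
  "column_strict N D = {f \<in> D \<rightarrow>\<^sub>E {1..N}. along_rows (\<le>) D f \<and> down_columns (<) D f}"

text \<open>Semistandard (k,l)-tableaux on sets of cells, so that recursion can pass to subdiagrams
  without returning to lists of parts. The agreement with \<open>semistandard_tableaux\<close> rests
  on \<open>diagram_iff_young_diagram\<close>.\<close>

definition super_tableaux :: "nat \<Rightarrow> nat \<Rightarrow> (nat \<times> nat) set \<Rightarrow> (nat \<times> nat \<Rightarrow> nat) set" where
  "super_tableaux k l D =
     {f \<in> D \<rightarrow>\<^sub>E {1..k+l}.
        let T = {c \<in> D. f c \<in> {1..k}}; S = D - T in
        diagram T \<and> along_rows (\<le>) T f \<and> down_columns (<) T f \<and>
        down_columns (\<le>) S f \<and> along_rows (<) S f}"

lemma along_rowsD: "along_rows R S f \<Longrightarrow> (i, j) \<in> S \<Longrightarrow> (i, j') \<in> S \<Longrightarrow> j < j' \<Longrightarrow> R (f (i, j)) (f (i, j'))"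
  unfolding along_rows_def by blast

lemma down_columnsD: "down_columns R S f \<Longrightarrow> (i, j) \<in> S \<Longrightarrow> (i', j) \<in> S \<Longrightarrow> i < i' \<Longrightarrow> R (f (i, j)) (f (i', j))"
  unfolding down_columns_def by blast

lemma along_rowsI: "(\<And>i j j'. (i, j) \<in> S \<Longrightarrow> (i, j') \<in> S \<Longrightarrow> j < j' \<Longrightarrow> R (f (i, j)) (f (i, j'))) \<Longrightarrow> along_rows R S f"
  unfolding along_rows_def by blast

lemma down_columnsI: "(\<And>i i' j. (i, j) \<in> S \<Longrightarrow> (i', j) \<in> S \<Longrightarrow> i < i' \<Longrightarrow> R (f (i, j)) (f (i', j))) \<Longrightarrow> down_columns R S f"
  unfolding down_columns_def by blast

lemma along_rows_subset: "along_rows R S f \<Longrightarrow> S' \<subseteq> S \<Longrightarrow> (\<And>c. c \<in> S' \<Longrightarrow> g c = f c) \<Longrightarrow> along_rows R S' g"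
  unfolding along_rows_def by (metis subsetD)

lemma down_columns_subset: "down_columns R S f \<Longrightarrow> S' \<subseteq> S \<Longrightarrow> (\<And>c. c \<in> S' \<Longrightarrow> g c = f c) \<Longrightarrow> down_columns R S' g"
  unfolding down_columns_def by (metis subsetD)

text \<open>Columns are strict, so the largest letter occurs at most once in each and occupies a
  horizontal strip. Conversely, filling a horizontal strip with a new largest letter violates
  neither condition.\<close>

lemma sum_column_strict_Suc:
  assumes D: "diagram D"
  shows "sum h (column_strict (Suc N) D) = (\<Sum>L\<in>horizontal_removals D. \<Sum>g\<in>column_strict N L. h (fill N L D g))"
proof (rule sum_remove_largest_letter)
  show "finite D" using D by (rule diagram_finite)
  show "column_strict (Suc N) D \<subseteq> D \<rightarrow>\<^sub>E {1..Suc N}" by (auto simp: column_strict_def)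
  show "L \<subseteq> D" if "L \<in> horizontal_removals D" for L using that by (auto simp: horizontal_removals_def)
  show "column_strict N L \<subseteq> L \<rightarrow>\<^sub>E {1..N}" for L by (auto simp: column_strict_def)
next
  fix f assume "f \<in> column_strict (Suc N) D"
  then have f: "f \<in> D \<rightarrow>\<^sub>E {1..Suc N}" and row: "along_rows (\<le>) D f" and col: "down_columns (<) D f"
    by (auto simp: column_strict_def)
  define L where "L = {c \<in> D. f c \<le> N}"
  have "diagram L"
  proof (rule diagramI)
    show "finite L" using diagram_finite[OF D] by (simp add: L_def)
    show "1 \<le> i \<and> 1 \<le> j" if "(i, j) \<in> L" for i j using diagram_pos[OF D] that by (auto simp: L_def)
    fix i j i' j' assume ij: "(i, j) \<in> L" "1 \<le> i'" "i' \<le> i" "1 \<le> j'" "j' \<le> j"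
    then have "(i', j') \<in> D" "(i, j') \<in> D" "(i, j) \<in> D" using diagram_down[OF D, of i j] by (auto simp: L_def)
    then have "f (i', j') \<le> f (i, j')" "f (i, j') \<le> f (i, j)"
      using ij along_rowsD[OF row, of i j' j] down_columnsD[OF col, of i' j' i] by (auto simp: le_less)
    then show "(i', j') \<in> L" using ij \<open>(i', j') \<in> D\<close> by (auto simp: L_def)
  qed
  moreover have "inj_on snd (D - L)"
  proof (rule inj_onI)
    fix c c' assume c: "c \<in> D - L" "c' \<in> D - L" "snd c = snd c'"
    obtain i i' j where [simp]: "c = (i, j)" "c' = (i', j)" using c by (metis prod.collapse)
    have "f c = Suc N" "f c' = Suc N" using c f by (auto simp: L_def PiE_iff le_Suc_eq)
    then show "c = c'" using down_columnsD[OF col, of i j i'] down_columnsD[OF col, of i' j i] c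
      by (cases i i' rule: linorder_cases) auto
  qed
  moreover have "restrict f L \<in> column_strict N L"
    using along_rows_subset[OF row, of L "restrict f L"] down_columns_subset[OF col, of L "restrict f L"] f
    by (auto simp: column_strict_def L_def PiE_iff)
  ultimately show "{c \<in> D. f c \<le> N} \<in> horizontal_removals D \<and>
      restrict f {c \<in> D. f c \<le> N} \<in> column_strict N {c \<in> D. f c \<le> N}"
    by (auto simp: L_def horizontal_removals_def)
next
  fix L g assume L: "L \<in> horizontal_removals D" and "g \<in> column_strict N L"
  then have g: "g \<in> L \<rightarrow>\<^sub>E {1..N}" and row: "along_rows (\<le>) L g" and col: "down_columns (<) L g"
    by (auto simp: column_strict_def)
  have L': "diagram L" "L \<subseteq> D" "inj_on snd (D - L)" using L by (auto simp: horizontal_removals_def)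
  have gle: "g c \<le> N" if "c \<in> L" for c using g that by auto
  have "along_rows (\<le>) D (fill N L D g)"
  proof (rule along_rowsI)
    fix i j j' assume ij: "(i, j) \<in> D" "(i, j') \<in> D" "j < j'"
    have "(i, j) \<in> L" if "(i, j') \<in> L"
      using diagram_down[OF L'(1) that, of i j] diagram_pos[OF D ij(1)] ij by auto
    then show "fill N L D g (i, j) \<le> fill N L D g (i, j')"
      using ij along_rowsD[OF row, of i j j'] gle[of "(i, j)"] by (auto simp: fill_def)
  qed
  moreover have "down_columns (<) D (fill N L D g)"
  proof (rule down_columnsI)
    fix i i' j assume ij: "(i, j) \<in> D" "(i', j) \<in> D" "i < i'"
    have "(i, j) \<in> L" if "(i', j) \<in> L"
      using diagram_down[OF L'(1) that, of i j] diagram_pos[OF D ij(1)] ij by auto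
    moreover have "(i, j) \<in> L \<or> (i', j) \<in> L"
      using inj_onD[OF L'(3), of "(i, j)" "(i', j)"] ij by auto
    ultimately show "fill N L D g (i, j) < fill N L D g (i', j)"
      using ij down_columnsD[OF col, of i j i'] gle[of "(i, j)"] by (auto simp: fill_def)
  qed
  moreover have "fill N L D g \<in> D \<rightarrow>\<^sub>E {1..Suc N}"
    using g L'(2) by (auto simp: fill_def PiE_iff extensional_def le_Suc_eq)
  ultimately show "fill N L D g \<in> column_strict (Suc N) D" by (simp add: column_strict_def)
qed

text \<open>Primed letters are strict along rows, so the largest one occupies a vertical strip. It
  exceeds k, hence its removal leaves the unprimed part T unchanged.\<close>

lemma sum_super_tableaux_Suc:
  assumes D: "diagram D"
  shows "sum h (super_tableaux k (Suc l) D) = (\<Sum>L\<in>vertical_removals D. \<Sum>g\<in>super_tableaux k l L. h (fill (k + l) L D g))"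
proof (rule sum_remove_largest_letter)
  show "finite D" using D by (rule diagram_finite)
  show "super_tableaux k (Suc l) D \<subseteq> D \<rightarrow>\<^sub>E {1..Suc (k + l)}" by (auto simp: super_tableaux_def)
  show "L \<subseteq> D" if "L \<in> vertical_removals D" for L using that by (auto simp: vertical_removals_def)
  show "super_tableaux k l L \<subseteq> L \<rightarrow>\<^sub>E {1..k + l}" for L by (auto simp: super_tableaux_def)
next
  fix f assume "f \<in> super_tableaux k (Suc l) D"
  define T where "T = {c \<in> D. f c \<in> {1..k}}"
  have f: "f \<in> D \<rightarrow>\<^sub>E {1..Suc (k + l)}" and T: "diagram T"
    and row: "along_rows (\<le>) T f" and col: "down_columns (<) T f"
    and row': "along_rows (<) (D - T) f" and col': "down_columns (\<le>) (D - T) f"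
    using \<open>f \<in> super_tableaux k (Suc l) D\<close> by (auto simp: super_tableaux_def T_def Let_def)
  define L where "L = {c \<in> D. f c \<le> k + l}"
  have TL: "T \<subseteq> L" "T = {c \<in> L. f c \<in> {1..k}}" by (auto simp: T_def L_def)
  have "diagram L"
  proof (rule diagramI)
    show "finite L" using diagram_finite[OF D] by (simp add: L_def)
    show "1 \<le> i \<and> 1 \<le> j" if "(i, j) \<in> L" for i j using diagram_pos[OF D] that by (auto simp: L_def)
    fix i j i' j' assume ij: "(i, j) \<in> L" "1 \<le> i'" "i' \<le> i" "1 \<le> j'" "j' \<le> j"
    then have inD: "(i', j') \<in> D" "(i', j) \<in> D" "(i, j) \<in> D" using diagram_down[OF D, of i j] by (auto simp: L_def)
    show "(i', j') \<in> L"
    \<comment> \<open>Inside T the letter is at most k. Outside T, all cells weakly below and right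
      of (i', j') are outside T as well, so the comparison can go along row i' and then down column
      j within \<open>D - T\<close>.\<close>
    proof (cases "(i', j') \<in> T")
      case True
      then show ?thesis using TL by auto
    next
      case False
      then have "(i', j) \<notin> T" "(i, j) \<notin> T"
        using diagram_down[OF T, of i' j i' j'] diagram_down[OF T, of i j i' j'] ij by auto
      then have "f (i', j') \<le> f (i', j)" "f (i', j) \<le> f (i, j)"
        using ij inD False along_rowsD[OF row', of i' j' j] down_columnsD[OF col', of i' j i] by (auto simp: le_less)
      then show "(i', j') \<in> L" using ij \<open>(i', j') \<in> D\<close> by (auto simp: L_def)
    qed
  qed
  moreover have "inj_on fst (D - L)"
  proof (rule inj_onI)
    fix c c' assume c: "c \<in> D - L" "c' \<in> D - L" "fst c = fst c'"
    obtain i j j' where [simp]: "c = (i, j)" "c' = (i, j')" using c by (metis prod.collapse)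
    have "f c = Suc (k + l)" "f c' = Suc (k + l)" using c f by (auto simp: L_def PiE_iff le_Suc_eq)
    then show "c = c'" using along_rowsD[OF row', of i j j'] along_rowsD[OF row', of i j' j] c TL
      by (cases j j' rule: linorder_cases) auto
  qed
  moreover have "restrict f L \<in> super_tableaux k l L"
  proof -
    have T': "{c \<in> L. restrict f L c \<in> {1..k}} = T" using TL by auto
    have "restrict f L \<in> L \<rightarrow>\<^sub>E {1..k + l}" using f by (auto simp: L_def PiE_iff)
    moreover have "along_rows (\<le>) T (restrict f L)" "down_columns (<) T (restrict f L)"
      "along_rows (<) (L - T) (restrict f L)" "down_columns (\<le>) (L - T) (restrict f L)"
      using TL by (auto intro!: along_rows_subset[OF row] down_columns_subset[OF col]
          along_rows_subset[OF row'] down_columns_subset[OF col'] simp: L_def)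
    ultimately show ?thesis using T unfolding super_tableaux_def mem_Collect_eq T' Let_def by blast
  qed
  ultimately show "{c \<in> D. f c \<le> k + l} \<in> vertical_removals D \<and>
      restrict f {c \<in> D. f c \<le> k + l} \<in> super_tableaux k l {c \<in> D. f c \<le> k + l}"
    by (auto simp: L_def vertical_removals_def)
next
  fix L g assume L: "L \<in> vertical_removals D" and gst: "g \<in> super_tableaux k l L"
  define T where "T = {c \<in> L. g c \<in> {1..k}}"
  have g: "g \<in> L \<rightarrow>\<^sub>E {1..k + l}" and T: "diagram T"
    and row: "along_rows (\<le>) T g" and col: "down_columns (<) T g"
    and row': "along_rows (<) (L - T) g" and col': "down_columns (\<le>) (L - T) g"
    using gst by (auto simp: super_tableaux_def T_def Let_def)
  have L': "diagram L" "L \<subseteq> D" "inj_on fst (D - L)" using L by (auto simp: vertical_removals_def)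
  have gle: "g c \<le> k + l" if "c \<in> L" for c using g that by auto
  define f where "f = fill (k + l) L D g"
  have fT: "f c = g c" if "c \<in> T" for c using that by (auto simp: f_def fill_def T_def)
  have fL: "f c = g c" if "c \<in> L" for c using that by (auto simp: f_def fill_def)
  have fD: "f c = Suc (k + l)" if "c \<in> D" "c \<notin> L" for c using that by (auto simp: f_def fill_def)
  have T': "{c \<in> D. f c \<in> {1..k}} = T"
    using L'(2) by (auto simp: f_def fill_def T_def)
  have "along_rows (<) (D - T) f"
  proof (rule along_rowsI)
    fix i j j' assume ij: "(i, j) \<in> D - T" "(i, j') \<in> D - T" "j < j'"
    have "(i, j) \<in> L" if "(i, j') \<in> L"
      using diagram_down[OF L'(1) that, of i j] diagram_pos[OF D, of i j] ij by auto
    moreover have "(i, j) \<in> L \<or> (i, j') \<in> L"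
      using inj_onD[OF L'(3), of "(i, j)" "(i, j')"] ij by auto
    ultimately show "f (i, j) < f (i, j')"
      using ij along_rowsD[OF row', of i j j'] gle[of "(i, j)"] fL fD by (cases "(i, j') \<in> L") auto
  qed
  moreover have "down_columns (\<le>) (D - T) f"
  proof (rule down_columnsI)
    fix i i' j assume ij: "(i, j) \<in> D - T" "(i', j) \<in> D - T" "i < i'"
    have "(i, j) \<in> L" if "(i', j) \<in> L"
      using diagram_down[OF L'(1) that, of i j] diagram_pos[OF D, of i j] ij by auto
    then show "f (i, j) \<le> f (i', j)"
      using ij down_columnsD[OF col', of i j i'] gle[of "(i, j)"] fL fD
      by (cases "(i', j) \<in> L"; cases "(i, j) \<in> L") auto
  qed
  moreover have "along_rows (\<le>) T f" "down_columns (<) T f"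
    using fT by (auto intro!: along_rows_subset[OF row] down_columns_subset[OF col])
  moreover have "f \<in> D \<rightarrow>\<^sub>E {1..k + Suc l}"
    using g L'(2) by (auto simp: f_def fill_def PiE_iff extensional_def le_Suc_eq)
  ultimately have "f \<in> super_tableaux k (Suc l) D"
    using T unfolding super_tableaux_def mem_Collect_eq T' Let_def by blast
  then show "fill (k + l) L D g \<in> super_tableaux k (Suc l) D" by (simp add: f_def)
qed

lemma super_tableaux_zero:
  assumes "diagram D"
  shows "super_tableaux k 0 D = column_strict k D"
proof -
  have "f \<in> super_tableaux k 0 D \<longleftrightarrow> f \<in> column_strict k D" for f
  proof (cases "f \<in> D \<rightarrow>\<^sub>E {1..k}")
    case True
    then have e: "{c \<in> D. f c \<in> {1..k}} = D" by auto
    show ?thesis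
      unfolding super_tableaux_def column_strict_def mem_Collect_eq e Let_def
      using assms by (simp add: along_rows_def down_columns_def)
  next
    case False
    then show ?thesis by (simp add: super_tableaux_def column_strict_def)
  qed
  then show ?thesis by blast
qed

section \<open>Diagrams of partitions\<close>

lemma partitions_of_nth_antimono:
  assumes "\<alpha> \<in> partitions_of n" "i \<le> j" "j < length \<alpha>"
  shows "\<alpha> ! j \<le> \<alpha> ! i"
  using assms sorted_wrt_nth_less[of "(\<ge>)" \<alpha> i j] by (cases "i = j") (auto simp: partitions_of_def)

lemma finite_young_diagram: "finite (young_diagram \<alpha>)"
proof (rule finite_subset)
  show "young_diagram \<alpha> \<subseteq> {1..length \<alpha>} \<times> {1..Max (insert 0 (set \<alpha>))}"
  proof (clarsimp simp: young_diagram_def)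
    fix i j assume "Suc 0 \<le> i" "i \<le> length \<alpha>" "j \<le> \<alpha> ! (i - Suc 0)"
    then have "\<alpha> ! (i - Suc 0) \<in> set \<alpha>" by auto
    then have "\<alpha> ! (i - Suc 0) \<le> Max (insert 0 (set \<alpha>))" by (intro Max_ge) auto
    then show "j \<le> Max (insert 0 (set \<alpha>))" using \<open>j \<le> \<alpha> ! (i - Suc 0)\<close> by linarith
  qed
qed auto

lemma diagram_young_diagram:
  assumes "\<alpha> \<in> partitions_of n"
  shows "diagram (young_diagram \<alpha>)"
proof (rule diagramI[OF finite_young_diagram])
  fix i j i' j' assume "(i, j) \<in> young_diagram \<alpha>" "1 \<le> i'" "i' \<le> i" "1 \<le> j'" "j' \<le> j"
  moreover from this have "\<alpha> ! (i - 1) \<le> \<alpha> ! (i' - 1)"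
    by (intro partitions_of_nth_antimono[OF assms]) (auto simp: young_diagram_def)
  ultimately show "(i', j') \<in> young_diagram \<alpha>"
    by (auto simp: young_diagram_def)
qed (auto simp: young_diagram_def)

lemma length_le_sum_list: "0 \<notin> set xs \<Longrightarrow> length xs \<le> sum_list (xs :: nat list)"
proof (induction xs)
  case (Cons a xs)
  then show ?case by (cases a) auto
qed simp

lemma initial_segment:
  fixes R :: "nat set"
  assumes fin: "finite R" and pos: "\<And>j. j \<in> R \<Longrightarrow> 1 \<le> j"
    and down: "\<And>j j'. j \<in> R \<Longrightarrow> 1 \<le> j' \<Longrightarrow> j' \<le> j \<Longrightarrow> j' \<in> R"
  shows "R = {1..card R}"
proof (cases "R = {}")
  case False
  have "R = {1..Max R}"
  proof
    show "R \<subseteq> {1..Max R}" using Max_ge[OF fin] pos by auto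
    show "{1..Max R} \<subseteq> R" using down[OF Max_in[OF fin False]] by (intro subsetI) simp
  qed
  then show ?thesis by (metis card_atLeastAtMost diff_Suc_1)
qed simp

lemma row_initial_segment:
  assumes D: "diagram D"
  shows "{j. (i, j) \<in> D} = {1..card {j. (i, j) \<in> D}}"
proof (rule initial_segment)
  show "finite {j. (i, j) \<in> D}"
    by (rule finite_subset[of _ "snd ` D"]) (use diagram_finite[OF D] in force)+
qed (use diagram_pos[OF D] diagram_down[OF D, of i _ i] in blast)+

lemma column_initial_segment:
  assumes D: "diagram D"
  shows "{i. (i, j) \<in> D} = {1..card {i. (i, j) \<in> D}}"
proof (rule initial_segment)
  show "finite {i. (i, j) \<in> D}"
    by (rule finite_subset[of _ "fst ` D"]) (use diagram_finite[OF D] in force)+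
qed (use diagram_pos[OF D] diagram_down[OF D, of _ j _ j] in blast)+

lemma diagram_eq_young_diagram:
  assumes D: "diagram D"
  obtains m \<mu> where "\<mu> \<in> partitions_of m" "D = young_diagram \<mu>"
proof -
  define r where "r i = card {j. (i, j) \<in> D}" for i
  define n where "n = card {i. (i, 1) \<in> D}"
  have mem: "(i, j) \<in> D \<longleftrightarrow> 1 \<le> j \<and> j \<le> r i" for i j
    using row_initial_segment[OF D, of i] unfolding r_def by (metis atLeastAtMost_iff mem_Collect_eq)
  have col: "{i. (i, 1) \<in> D} = {1..n}"
    unfolding n_def using D by (rule column_initial_segment)
  have rpos: "1 \<le> r i \<longleftrightarrow> 1 \<le> i \<and> i \<le> n" for i
  proof -
    have "1 \<le> r i \<longleftrightarrow> (i, 1) \<in> D" using mem by auto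
    also have "\<dots> \<longleftrightarrow> i \<in> {1..n}" using col by blast
    finally show ?thesis by simp
  qed
  have anti: "r i' \<le> r i" if "1 \<le> i" "i \<le> i'" for i i'
  proof (cases "r i' = 0")
    case False
    then have "(i', r i') \<in> D" using mem by auto
    then have "(i, r i') \<in> D" using diagram_down[OF D, of i' "r i'" i "r i'"] that False by auto
    then show ?thesis using mem by auto
  qed simp
  define \<mu> where "\<mu> = map (\<lambda>i. r (Suc i)) [0..<n]"
  have "sorted_wrt (\<ge>) \<mu>"
    unfolding sorted_wrt_iff_nth_less by (auto simp: \<mu>_def intro!: anti)
  moreover have "0 \<notin> set \<mu>"
  proof
    assume "0 \<in> set \<mu>"
    then obtain i where "i < n" "r (Suc i) = 0" by (auto simp: \<mu>_def)
    then show False using rpos[of "Suc i"] by simp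
  qed
  ultimately have "\<mu> \<in> partitions_of (sum_list \<mu>)" by (simp add: partitions_of_def)
  moreover have "D = young_diagram \<mu>"
  proof -
    have "(i, j) \<in> D \<longleftrightarrow> (i, j) \<in> young_diagram \<mu>" for i j
    proof -
      have "(i, j) \<in> D \<longleftrightarrow> 1 \<le> i \<and> i \<le> n \<and> 1 \<le> j \<and> j \<le> r i" using mem[of i j] rpos[of i] by auto
      also have "\<dots> \<longleftrightarrow> (i, j) \<in> young_diagram \<mu>" by (auto simp: young_diagram_def \<mu>_def)
      finally show ?thesis .
    qed
    then show ?thesis by auto
  qed
  ultimately show ?thesis by (rule that)
qed

lemma diagram_iff_young_diagram:
  "diagram T \<longleftrightarrow> (\<exists>m. \<exists>\<mu>\<in>partitions_of m. T = young_diagram \<mu>)"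
  using diagram_eq_young_diagram diagram_young_diagram by metis

lemma young_diagram_inject:
  assumes "\<alpha> \<in> partitions_of n" "\<beta> \<in> partitions_of m" "young_diagram \<alpha> = young_diagram \<beta>"
  shows "\<alpha> = \<beta>"
proof -
  \<comment> \<open>Zero parts would be invisible in the diagram; as all parts are positive, the
    first column has exactly one cell per part.\<close>
  have len: "length \<alpha> = card {i. (i, 1) \<in> young_diagram \<alpha>}" if "\<alpha> \<in> partitions_of n" for \<alpha> n
  proof -
    have "1 \<le> \<alpha> ! (i - 1)" if "1 \<le> i" "i \<le> length \<alpha>" for i
    proof -
      have "\<alpha> ! (i - 1) \<in> set \<alpha>" using that by auto
      moreover have "0 \<notin> set \<alpha>" using \<open>\<alpha> \<in> partitions_of n\<close> by (simp add: partitions_of_def)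
      ultimately have "\<alpha> ! (i - 1) \<noteq> 0" by metis
      then show ?thesis by simp
    qed
    then have "{i. (i, 1) \<in> young_diagram \<alpha>} = {1..length \<alpha>}"
      by (auto simp: young_diagram_def)
    then show ?thesis by simp
  qed
  have row: "\<alpha> ! i = card {j. (Suc i, j) \<in> young_diagram \<alpha>}" if "i < length \<alpha>" for \<alpha> i
  proof -
    have "{j. (Suc i, j) \<in> young_diagram \<alpha>} = {1..\<alpha> ! i}" using that by (auto simp: young_diagram_def)
    then show ?thesis by simp
  qed
  show ?thesis
  proof (rule nth_equalityI)
    show "length \<alpha> = length \<beta>" using len[OF assms(1)] len[OF assms(2)] assms(3) by simp
    then show "\<alpha> ! i = \<beta> ! i" if "i < length \<alpha>" for i
      using row[of i \<alpha>] row[of i \<beta>] that assms(3) by simp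
  qed
qed

lemma finite_partitions_of: "finite (partitions_of n)"
proof (rule finite_subset)
  show "partitions_of n \<subseteq> {xs. set xs \<subseteq> {..n} \<and> length xs \<le> n}"
    using length_le_sum_list member_le_sum_list by (fastforce simp: partitions_of_def)
qed (rule finite_lists_length_le, simp)

section \<open>Branching rules for Schur polynomials and super tableau counts\<close>

definition schur_sum :: "nat \<Rightarrow> (nat \<Rightarrow> complex) \<Rightarrow> (nat \<times> nat) set \<Rightarrow> complex" where
  "schur_sum N x D = (\<Sum>f\<in>column_strict N D. \<Prod>c\<in>D. x (f c))"

definition super_count :: "nat \<Rightarrow> nat \<Rightarrow> (nat \<times> nat) set \<Rightarrow> complex" where
  "super_count k l D = of_nat (card (super_tableaux k l D))"

lemma schur_function_eq_schur_sum: "schur_function \<alpha> N x = schur_sum N x (young_diagram \<alpha>)"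
  by (simp add: schur_function_def schur_sum_def ordinary_tableaux_def column_strict_def)

lemma num_tableaux_eq_super_count:
  "of_nat (num_tableaux k l \<alpha>) = super_count k l (young_diagram \<alpha>)"
  by (simp add: num_tableaux_def super_count_def semistandard_tableaux_def super_tableaux_def
      flip: diagram_iff_young_diagram)

text \<open>Branching rule: each cell of the removed horizontal strip carries the letter N + 1 and
  contributes one factor \<open>x (Suc N)\<close>.\<close>

lemma schur_sum_Suc:
  assumes D: "diagram D"
  shows "schur_sum (Suc N) x D = hstep (x (Suc N)) (schur_sum N x) D"
  unfolding schur_sum_def sum_column_strict_Suc[OF D] hstep_def sum_distrib_left
proof (intro sum.cong refl)
  fix L g assume L: "L \<in> horizontal_removals D" and "g \<in> column_strict N L"
  have LD: "L \<subseteq> D" "finite D" using L D diagram_finite by (auto simp: horizontal_removals_def)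
  have "(\<Prod>c\<in>D. x (fill N L D g c)) = (\<Prod>c\<in>D - L. x (fill N L D g c)) * (\<Prod>c\<in>L. x (fill N L D g c))"
    by (rule prod.subset_diff[OF LD])
  also have "(\<Prod>c\<in>D - L. x (fill N L D g c)) = (\<Prod>c\<in>D - L. x (Suc N))"
    by (rule prod.cong) (auto simp: fill_def)
  also have "(\<Prod>c\<in>L. x (fill N L D g c)) = (\<Prod>c\<in>L. x (g c))"
    by (rule prod.cong) (auto simp: fill_def)
  finally show "(\<Prod>c\<in>D. x (fill N L D g c)) = x (Suc N) ^ card (D - L) * (\<Prod>c\<in>L. x (g c))"
    by simp
qed

lemma super_count_Suc:
  assumes D: "diagram D"
  shows "super_count k (Suc l) D = vstep (super_count k l) D"
  using sum_super_tableaux_Suc[OF D, of "\<lambda>_. 1 :: complex" k l]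
  by (simp add: super_count_def vstep_def)

lemma super_count_zero:
  assumes D: "diagram D"
  shows "super_count k 0 D = schur_sum k (\<lambda>_. 1) D"
  by (simp add: super_count_def super_tableaux_zero[OF D] schur_sum_def)

lemma schur_sum_cong:
  assumes "\<And>j. 1 \<le> j \<Longrightarrow> j \<le> N \<Longrightarrow> x j = y j"
  shows "schur_sum N x D = schur_sum N y D"
  unfolding schur_sum_def
proof (intro sum.cong prod.cong refl)
  fix f c assume "f \<in> column_strict N D" "c \<in> D"
  then have "f c \<in> {1..N}" by (auto simp: column_strict_def)
  then show "x (f c) = y (f c)" using assms by auto
qed

section \<open>Polynomiality and specialization of Schur functions\<close>

text \<open>The binomial basis suits difference equations, since the difference operator merely
  lowers the lower index. The argument is an integer, so negative m is covered, and d is only an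
  upper bound on the degree.\<close>

definition numerical_polynomial :: "nat \<Rightarrow> (int \<Rightarrow> complex) \<Rightarrow> bool" where
  "numerical_polynomial d f \<longleftrightarrow> (\<exists>c. \<forall>m. f m = (\<Sum>j\<le>d. c j * (of_int m gchoose j)))"

lemma numerical_polynomialI:
  "(\<And>m. f m = (\<Sum>j\<le>d. c j * (of_int m gchoose j))) \<Longrightarrow> numerical_polynomial d f"
  unfolding numerical_polynomial_def by (rule exI[of _ c]) simp

lemma numerical_polynomial_mono:
  assumes "numerical_polynomial d f" "d \<le> e"
  shows "numerical_polynomial e f"
proof -
  obtain c where c: "\<And>m. f m = (\<Sum>j\<le>d. c j * (of_int m gchoose j))"
    using assms unfolding numerical_polynomial_def by blast
  have "f m = (\<Sum>j\<le>e. (if j \<le> d then c j else 0) * (of_int m gchoose j))" for m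
    unfolding c using assms(2) by (intro sum.mono_neutral_cong_left) auto
  then show ?thesis by (rule numerical_polynomialI)
qed

lemma numerical_polynomial_sum:
  assumes "\<And>i. i \<in> I \<Longrightarrow> numerical_polynomial d (f i)"
  shows "numerical_polynomial d (\<lambda>m. \<Sum>i\<in>I. a i * f i m)"
proof -
  obtain c where c: "\<And>i m. i \<in> I \<Longrightarrow> f i m = (\<Sum>j\<le>d. c i j * (of_int m gchoose j))"
    using assms unfolding numerical_polynomial_def by metis
  have "(\<Sum>i\<in>I. a i * f i m) = (\<Sum>j\<le>d. (\<Sum>i\<in>I. a i * c i j) * (of_int m gchoose j))" for m
  proof -
    have "(\<Sum>i\<in>I. a i * f i m) = (\<Sum>i\<in>I. \<Sum>j\<le>d. a i * c i j * (of_int m gchoose j))"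
      by (simp add: c sum_distrib_left mult.assoc)
    also have "\<dots> = (\<Sum>j\<le>d. \<Sum>i\<in>I. a i * c i j * (of_int m gchoose j))" by (rule sum.swap)
    finally show ?thesis by (simp add: sum_distrib_right)
  qed
  then show ?thesis by (rule numerical_polynomialI)
qed

text \<open>By Pascal's rule, raising every lower index by one gives an antidifference F of g. Then
  f - F has difference zero, hence is constant on all integers by induction in both directions from
  0.\<close>

lemma numerical_polynomial_antidifference:
  assumes "numerical_polynomial d g" and step: "\<And>m. f (m + 1) - f m = g m"
  shows "numerical_polynomial (Suc d) f"
proof -
  obtain c where c: "\<And>m. g m = (\<Sum>j\<le>d. c j * (of_int m gchoose j))"
    using assms unfolding numerical_polynomial_def by blast
  define F where "F m = (\<Sum>j\<le>d. c j * (of_int m gchoose Suc j))" for m :: int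
  have F: "F (m + 1) - F m = g m" for m
    by (simp add: F_def c gbinomial_Suc_Suc ring_distribs sum.distrib)
  have "f m - F m = f 0 - F 0" for m
  proof (induction m rule: int_induct[of _ 0])
    case (step1 i)
    then show ?case using F[of i] step[of i] by (simp add: algebra_simps)
  next
    case (step2 i)
    then show ?case using F[of "i - 1"] step[of "i - 1"] by (simp add: algebra_simps)
  qed simp
  then have "f m = (f 0 - F 0) + F m" for m by (metis diff_add_cancel)
  moreover have "(f 0 - F 0) + F m = (\<Sum>j\<le>Suc d. (case j of 0 \<Rightarrow> f 0 - F 0 | Suc i \<Rightarrow> c i) * (of_int m gchoose j))" for m
    unfolding sum.atMost_Suc_shift by (simp add: F_def)
  ultimately have "f m = (\<Sum>j\<le>Suc d. (case j of 0 \<Rightarrow> f 0 - F 0 | Suc i \<Rightarrow> c i) * (of_int m gchoose j))" for m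
    by simp
  then show ?thesis by (rule numerical_polynomialI)
qed

text \<open>A genuine polynomial is needed because equality on the natural numbers is to be
  transferred to a negative integer.\<close>

lemma numerical_polynomial_imp_poly:
  assumes "numerical_polynomial d f"
  obtains p where "\<And>m. f m = poly p (of_int m)"
proof -
  obtain c where c: "\<And>m. f m = (\<Sum>j\<le>d. c j * (of_int m gchoose j))"
    using assms unfolding numerical_polynomial_def by blast
  define p where "p = (\<Sum>j\<le>d. Polynomial.smult (c j / fact j) (\<Prod>i<j. [:- of_nat i, 1:]))"
  have "f m = poly p (of_int m)" for m
    by (simp add: c p_def poly_sum poly_prod gbinomial_prod_rev atLeast0LessThan)
  then show ?thesis by (rule that)
qed

lemma hstep_cong:
  assumes "\<And>L. diagram L \<Longrightarrow> v L = w L"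
  shows "hstep t v D = hstep t w D"
  unfolding hstep_def using assms by (intro sum.cong) (auto simp: horizontal_removals_def)

text \<open>For $m \ge 0$ this is the Schur function at $(1^k, (-1)^m)$. The values at negative \<open>m\<close> are chosen so
  that \<open>m \<mapsto> m + 1\<close> is always \<open>hstep (- 1)\<close>.\<close>

definition specialization :: "nat \<Rightarrow> int \<Rightarrow> (nat \<times> nat) set \<Rightarrow> complex" where
  "specialization k m D =
     (if m \<ge> 0 then schur_sum (k + nat m) (\<lambda>j. if j \<le> k then 1 else -1) D
      else super_count k (nat (- m)) D)"

lemma specialization_nat:
  "specialization k (int m) D = schur_sum (k + m) (\<lambda>j. if j \<le> k then 1 else -1) D"
  by (simp add: specialization_def)

lemma specialization_uminus:
  assumes D: "diagram D"
  shows "specialization k (- int l) D = super_count k l D"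
proof (cases l)
  case 0
  then show ?thesis
    using super_count_zero[OF D, of k] schur_sum_cong[of k "\<lambda>j. if j \<le> k then 1 else -1" "\<lambda>_. 1" D]
    by (simp add: specialization_def)
next
  case (Suc i)
  then show ?thesis by (simp add: specialization_def del: of_nat_Suc)
qed

text \<open>For m \<ge> 0 this is the branching rule with a new variable -1. For m = -(i + 1), the
  value is \<open>vstep\<close> applied to the count with i primed letters, and
  \<open>hstep (- 1)\<close> undoes that.\<close>

lemma specialization_step:
  assumes D: "diagram D"
  shows "specialization k (m + 1) D = hstep (- 1) (specialization k m) D"
proof (cases "m \<ge> 0")
  case True
  then obtain i where i: "m = int i" using nonneg_int_cases by blast
  have "specialization k (m + 1) D = schur_sum (Suc (k + i)) (\<lambda>j. if j \<le> k then 1 else -1) D"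
    using specialization_nat[of k "Suc i" D] by (simp add: i add.commute)
  also have "\<dots> = hstep (- 1) (schur_sum (k + i) (\<lambda>j. if j \<le> k then 1 else -1)) D"
    by (simp add: schur_sum_Suc[OF D])
  also have "\<dots> = hstep (- 1) (specialization k m) D"
    by (rule hstep_cong) (simp add: i specialization_nat)
  finally show ?thesis .
next
  case False
  then obtain i where i: "m = - int (Suc i)" by (metis linorder_not_le int_cases nonneg_int_cases nat_int of_nat_0_le_iff negD)
  have "hstep (- 1) (specialization k m) D = hstep (- 1) (vstep (super_count k i)) D"
    unfolding i by (rule hstep_cong) (simp only: specialization_uminus super_count_Suc)
  also have "\<dots> = super_count k i D" by (rule hstep_vstep[OF D])
  also have "\<dots> = specialization k (m + 1) D"
    using specialization_uminus[OF D, of k i] by (simp add: i)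
  finally show ?thesis by simp
qed

text \<open>The term L = D of \<open>hstep (- 1)\<close> has coefficient 1, so the difference in m
  involves only proper subdiagrams and induction on the number of cells applies. The extra 1 in the
  degree bound lets the empty diagram, whose difference is an empty sum, follow the general
  case.\<close>

lemma numerical_polynomial_specialization:
  assumes "diagram D"
  shows "numerical_polynomial (Suc (card D)) (\<lambda>m. specialization k m D)"
  using assms
proof (induction "card D" arbitrary: D rule: less_induct)
  case less
  have finD: "finite D" using less.prems by (rule diagram_finite)
  let ?R = "horizontal_removals D - {D}"
  show ?case
  proof (rule numerical_polynomial_antidifference)
    show "numerical_polynomial (card D) (\<lambda>m. \<Sum>L\<in>?R. (- 1) ^ card (D - L) * specialization k m L)"
    proof (rule numerical_polynomial_sum)
      fix L assume "L \<in> ?R"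
      then have L: "diagram L" "L \<subset> D" by (auto simp: horizontal_removals_def)
      then have "card L < card D" using finD by (intro psubset_card_mono)
      then show "numerical_polynomial (card D) (\<lambda>m. specialization k m L)"
        using numerical_polynomial_mono[OF less.hyps[OF _ L(1)], of "card D"] by simp
    qed
    show "specialization k (m + 1) D - specialization k m D
        = (\<Sum>L\<in>?R. (- 1) ^ card (D - L) * specialization k m L)" for m
      unfolding specialization_step[OF less.prems] hstep_def
      using sum.remove[OF finite_horizontal_removals[OF finD] self_horizontal_removal[OF less.prems],
          of "\<lambda>L. (- 1) ^ card (D - L) * specialization k m L"] by simp
  qed
qed

lemma poly_eq_of_nat_eq:
  fixes p q :: "complex poly"
  assumes "\<And>m :: nat. poly p (of_nat m) = poly q (of_nat m)"
  shows "p = q"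
proof (rule ccontr)
  assume "p \<noteq> q"
  then have "finite {x. poly (p - q) x = 0}" by (intro poly_roots_finite) simp
  moreover have "range (of_nat :: nat \<Rightarrow> complex) \<subseteq> {x. poly (p - q) x = 0}" using assms by auto
  ultimately have "finite (range (of_nat :: nat \<Rightarrow> complex))" by (rule rev_finite_subset)
  moreover have "inj (of_nat :: nat \<Rightarrow> complex)" by (simp add: inj_def)
  ultimately show False using range_inj_infinite by blast
qed

text \<open>The expansion is an identity for every number of variables, so it can be evaluated at k
  ones and m values -1 for every m. Both sides are polynomials in m and may then be compared at m =
  -l.\<close>

lemma num_tableaux_power_sum_expansion:
  assumes \<alpha>: "\<alpha> \<in> partitions_of n"
    and expansion: "\<And>N x. schur_function \<alpha> N x = (\<Sum>s\<in>S. a s * power_sum (\<nu> s) N x)"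
  shows "of_nat (num_tableaux k l \<alpha>) = (\<Sum>s\<in>S. a s * (\<Prod>r\<leftarrow>\<nu> s. of_nat k - (- 1) ^ r * of_nat l))"
proof -
  let ?D = "young_diagram \<alpha>"
  have D: "diagram ?D" using \<alpha> by (rule diagram_young_diagram)
  obtain q where q: "\<And>m. specialization k m ?D = poly q (of_int m)"
    using numerical_polynomial_specialization[OF D, of k] by (rule numerical_polynomial_imp_poly) blast
  \<comment> \<open>The linear factor is the power sum of degree r at k ones and m values -1, as a
    polynomial in m.\<close>
  define p where "p = (\<Sum>s\<in>S. Polynomial.smult (a s) (\<Prod>r\<leftarrow>\<nu> s. [:of_nat k, (- 1) ^ r:]))"
  have p: "poly p z = (\<Sum>s\<in>S. a s * (\<Prod>r\<leftarrow>\<nu> s. of_nat k + z * (- 1) ^ r))" for z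
  proof -
    have "poly (\<Prod>r\<leftarrow>xs. [:of_nat k, (- 1) ^ r:]) z = (\<Prod>r\<leftarrow>xs. of_nat k + z * (- 1) ^ r)" for xs
      by (induction xs) (simp_all add: algebra_simps)
    then show ?thesis by (simp add: p_def poly_sum)
  qed
  have "p = q"
  proof (rule poly_eq_of_nat_eq)
    fix m :: nat
    let ?x = "\<lambda>j. if j \<le> k then 1 else (- 1 :: complex)"
    have "(\<Sum>j=1..k + m. ?x j ^ r) = of_nat k + of_nat m * (- 1) ^ r" for r
    proof -
      have "(\<Sum>j=1..k + m. ?x j ^ r) = (\<Sum>j\<in>{1..k} \<union> {k + 1..k + m}. ?x j ^ r)"
        by (intro sum.cong) auto
      also have "\<dots> = (\<Sum>j=1..k. ?x j ^ r) + (\<Sum>j=k + 1..k + m. ?x j ^ r)"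
        by (rule sum.union_disjoint) auto
      also have "(\<Sum>j=1..k. ?x j ^ r) = (\<Sum>j=1..k. 1)" by (rule sum.cong) auto
      also have "(\<Sum>j=k + 1..k + m. ?x j ^ r) = (\<Sum>j=k + 1..k + m. (- 1) ^ r)" by (rule sum.cong) auto
      finally show ?thesis by simp
    qed
    then have "poly p (of_nat m) = schur_function \<alpha> (k + m) ?x"
      by (simp add: expansion power_sum_def p)
    also have "\<dots> = poly q (of_nat m)"
      using q[of "int m"] by (simp add: schur_function_eq_schur_sum specialization_nat)
    finally show "poly p (of_nat m) = poly q (of_nat m)" .
  qed
  have "of_nat (num_tableaux k l \<alpha>) = poly q (- of_nat l)"
    using q[of "- int l"] by (simp add: num_tableaux_eq_super_count specialization_uminus[OF D])
  also have "\<dots> = (\<Sum>s\<in>S. a s * (\<Prod>r\<leftarrow>\<nu> s. of_nat k - (- 1) ^ r * of_nat l))"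
    by (simp add: p flip: \<open>p = q\<close>) (simp add: algebra_simps)
  finally show ?thesis .
qed

section \<open>Recovering a partition from its Schur function\<close>

lemma column_strict_ge_row:
  assumes D: "diagram D" and f: "f \<in> column_strict N D" and "(i, j) \<in> D"
  shows "i \<le> f (i, j)"
  using \<open>(i, j) \<in> D\<close>
proof (induction i)
  case (Suc i)
  show ?case
  proof (cases "i = 0")
    case True
    have "f (Suc i, j) \<in> {1..N}" using f Suc.prems by (auto simp: column_strict_def)
    then show ?thesis using True by simp
  next
    case False
    then have "(i, j) \<in> D" using diagram_down[OF D Suc.prems, of i j] diagram_pos[OF D Suc.prems] by simp
    moreover from this have "f (i, j) < f (Suc i, j)"
      using f Suc.prems by (intro down_columnsD[of "(<)" D f]) (auto simp: column_strict_def)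
    ultimately show ?thesis using Suc.IH by simp
  qed
qed simp

text \<open>Set the variables with index at most p to t and the others to 1. An entry is at least
  its row number, so letters up to p occur only in the first p rows, which bounds the degree in t;
  filling each cell with its row number attains the bound.\<close>

lemma rows_eq_of_schur_sum_eq:
  assumes D: "diagram D" and E: "diagram E"
    and eq: "\<And>N x. schur_sum N x D = schur_sum N x E"
  shows "card {c \<in> D. fst c \<le> p} = card {c \<in> E. fst c \<le> p}"
proof -
  \<comment> \<open>Enough letters for the filling by row numbers in both diagrams; the inserted 0
    covers the case that both are empty.\<close>
  define N where "N = Max (insert 0 (fst ` (D \<union> E)))"
  have N: "fst c \<le> N" if "c \<in> D \<union> E" for c
    unfolding N_def using that diagram_finite[OF D] diagram_finite[OF E] by (intro Max_ge) auto
  define Q where "Q D = (\<Sum>f\<in>column_strict N D. monom (1 :: complex) (card {c \<in> D. f c \<le> p}))" for D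
  have poly_Q: "poly (Q D) t = schur_sum N (\<lambda>j. if j \<le> p then t else 1) D" if "diagram D" for D t
  proof -
    have "(\<Prod>c\<in>D. if f c \<le> p then t else 1) = t ^ card {c \<in> D. f c \<le> p}" for f :: "nat \<times> nat \<Rightarrow> nat"
      using diagram_finite[OF that] by (simp add: prod.If_cases Int_def)
    then show ?thesis by (simp add: Q_def schur_sum_def poly_sum poly_monom)
  qed
  have deg: "degree (Q D) = card {c \<in> D. fst c \<le> p}" if D: "diagram D" and N: "\<And>c. c \<in> D \<Longrightarrow> fst c \<le> N" for D
  proof (rule antisym)
    have finD: "finite D" using D by (rule diagram_finite)
    have fin: "finite (column_strict N D)"
      by (rule finite_subset[of _ "D \<rightarrow>\<^sub>E {1..N}"]) (use finD in \<open>auto simp: column_strict_def intro!: finite_PiE\<close>)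
    have le: "card {c \<in> D. f c \<le> p} \<le> card {c \<in> D. fst c \<le> p}" if "f \<in> column_strict N D" for f
      using finD by (intro card_mono) (auto dest: column_strict_ge_row[OF D that])
    \<comment> \<open>The coefficients are numbers of tableaux, so the top term cannot
      cancel.\<close>
    have coeff_Q: "coeff (Q D) m = of_nat (card {f \<in> column_strict N D. card {c \<in> D. f c \<le> p} = m})" for m
      using fin by (simp add: Q_def coeff_sum sum.If_cases Int_def)
    show "degree (Q D) \<le> card {c \<in> D. fst c \<le> p}"
    proof (rule degree_le, intro allI impI)
      fix m assume "card {c \<in> D. fst c \<le> p} < m"
      then have empty: "{f \<in> column_strict N D. card {c \<in> D. f c \<le> p} = m} = {}" using le by fastforce
      show "coeff (Q D) m = 0" unfolding coeff_Q empty by simp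
    qed
    have "restrict fst D \<in> column_strict N D"
      using N diagram_pos[OF D] by (force simp: column_strict_def along_rows_def down_columns_def)
    moreover have "{c \<in> D. restrict fst D c \<le> p} = {c \<in> D. fst c \<le> p}" by auto
    ultimately have "restrict fst D \<in> {f \<in> column_strict N D. card {c \<in> D. f c \<le> p} = card {c \<in> D. fst c \<le> p}}"
      by simp
    then have "coeff (Q D) (card {c \<in> D. fst c \<le> p}) \<noteq> 0"
      unfolding coeff_Q of_nat_eq_0_iff using fin by (subst card_eq_0_iff) auto
    then show "card {c \<in> D. fst c \<le> p} \<le> degree (Q D)" by (rule le_degree)
  qed
  have "Q D = Q E" unfolding poly_eq_poly_eq_iff[symmetric] by (auto simp: fun_eq_iff poly_Q D E eq)
  then show ?thesis using deg[OF D] deg[OF E] N by simp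
qed

lemma schur_function_inject:
  assumes \<alpha>: "\<alpha> \<in> partitions_of n" and \<beta>: "\<beta> \<in> partitions_of m" and eq: "schur_function \<alpha> = schur_function \<beta>"
  shows "\<alpha> = \<beta>"
proof -
  let ?D = "young_diagram \<alpha>" and ?E = "young_diagram \<beta>"
  have D: "diagram ?D" and E: "diagram ?E" using diagram_young_diagram \<alpha> \<beta> by auto
  have rows: "card {c \<in> ?D. fst c \<le> p} = card {c \<in> ?E. fst c \<le> p}" for p
    by (rule rows_eq_of_schur_sum_eq[OF D E]) (metis eq schur_function_eq_schur_sum)
  \<comment> \<open>Row lengths are the differences of these partial sums for consecutive p.\<close>
  have row: "card {c \<in> F. fst c \<le> Suc p} = card {c \<in> F. fst c \<le> p} + card {j. (Suc p, j) \<in> F}"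
    if "finite F" for p and F :: "(nat \<times> nat) set"
  proof -
    have "{c \<in> F. fst c \<le> Suc p} = {c \<in> F. fst c \<le> p} \<union> Pair (Suc p) ` {j. (Suc p, j) \<in> F}"
      by (auto simp: le_Suc_eq image_iff)
    moreover have "finite {j. (Suc p, j) \<in> F}"
      by (rule finite_subset[of _ "snd ` F"]) (use that in force)+
    moreover have "card (Pair (Suc p) ` {j. (Suc p, j) \<in> F}) = card {j. (Suc p, j) \<in> F}"
      by (rule card_image) (simp add: inj_on_def)
    moreover have "{c \<in> F. fst c \<le> p} \<inter> Pair (Suc p) ` {j. (Suc p, j) \<in> F} = {}" by auto
    ultimately show ?thesis using that by (simp add: card_Un_disjoint)
  qed
  have "card {j. (i, j) \<in> ?D} = card {j. (i, j) \<in> ?E}" for i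
  proof (cases i)
    case 0
    then have "{j. (i, j) \<in> ?D} = {}" "{j. (i, j) \<in> ?E} = {}" by (auto simp: young_diagram_def)
    then show ?thesis by simp
  next
    case (Suc p)
    then show ?thesis using row[OF diagram_finite[OF D], of p] row[OF diagram_finite[OF E], of p] rows by simp
  qed
  then have "{j. (i, j) \<in> ?D} = {j. (i, j) \<in> ?E}" for i
    using row_initial_segment[OF D, of i] row_initial_segment[OF E, of i] by simp
  then have "?D = ?E" by auto
  then show ?thesis by (rule young_diagram_inject[OF \<alpha> \<beta>])
qed

section \<open>Orthogonality of irreducible characters\<close>

lemma mult_mat_entry:
  assumes "A \<in> carrier_mat n m" "B \<in> carrier_mat m p" "i < n" "j < p"
  shows "(A * B) $$ (i, j) = (\<Sum>k<m. A $$ (i, k) * B $$ (k, j))"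
  using assms by (simp add: scalar_prod_def atLeast0LessThan)

lemma trace_mult_comm:
  fixes A B :: "'a :: comm_semiring_0 mat"
  assumes A: "A \<in> carrier_mat n m" and B: "B \<in> carrier_mat m n"
  shows "(\<Sum>i<n. (A * B) $$ (i, i)) = (\<Sum>j<m. (B * A) $$ (j, j))"
proof -
  have "(\<Sum>i<n. (A * B) $$ (i, i)) = (\<Sum>i<n. \<Sum>j<m. A $$ (i, j) * B $$ (j, i))"
    by (simp add: mult_mat_entry[OF A B])
  also have "\<dots> = (\<Sum>j<m. \<Sum>i<n. B $$ (j, i) * A $$ (i, j))"
    by (subst sum.swap) (simp add: mult.commute)
  also have "\<dots> = (\<Sum>j<m. (B * A) $$ (j, j))" by (simp add: mult_mat_entry[OF B A])
  finally show ?thesis .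
qed

lemma subspace_vecI:
  assumes "W \<subseteq> carrier_vec d" "0\<^sub>v d \<in> W" "\<And>v w. v \<in> W \<Longrightarrow> w \<in> W \<Longrightarrow> v + w \<in> W"
    "\<And>c v. v \<in> W \<Longrightarrow> c \<cdot>\<^sub>v v \<in> W"
  shows "VectorSpace.subspace class_ring W (module_vec TYPE(complex) d)"
  unfolding VectorSpace.subspace_def LinearCombinations.submodule_def
  using assms vec_vs vec_module by (auto simp: module_vec_simps)

lemma representation_carrier: "representation G d \<rho> \<Longrightarrow> g \<in> carrier G \<Longrightarrow> \<rho> g \<in> carrier_mat d d"
  unfolding representation_def hom_def units_of_def Units_def by (auto simp: ring_mat_simps)

lemma representation_mult:
  "representation G d \<rho> \<Longrightarrow> g \<in> carrier G \<Longrightarrow> h \<in> carrier G \<Longrightarrow> \<rho> (g \<otimes>\<^bsub>G\<^esub> h) = \<rho> g * \<rho> h"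
  unfolding representation_def hom_def units_of_def by (auto simp: ring_mat_simps)

lemma representation_one:
  assumes "representation G d \<rho>" "group G"
  shows "\<rho> \<one>\<^bsub>G\<^esub> = 1\<^sub>m d"
proof -
  interpret R: semiring "ring_mat TYPE(complex) d ()" by (rule semiring_mat)
  have "\<rho> \<one>\<^bsub>G\<^esub> = \<one>\<^bsub>units_of (ring_mat TYPE(complex) d ())\<^esub>"
    using assms by (intro hom_one R.units_group) (simp_all add: representation_def)
  then show ?thesis by (simp add: units_of_def ring_mat_simps)
qed

text \<open>Invertibility of each matrix comes for free: the image of the inverse element is a
  two-sided inverse.\<close>

lemma representationI:
  assumes G: "group G"
    and car: "\<And>g. g \<in> carrier G \<Longrightarrow> \<rho> g \<in> carrier_mat d d"
    and mult: "\<And>g h. g \<in> carrier G \<Longrightarrow> h \<in> carrier G \<Longrightarrow> \<rho> (g \<otimes>\<^bsub>G\<^esub> h) = \<rho> g * \<rho> h"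
    and one: "\<rho> \<one>\<^bsub>G\<^esub> = 1\<^sub>m d"
  shows "representation G d \<rho>"
proof -
  interpret group G by (rule G)
  have "\<rho> g \<in> Units (ring_mat TYPE(complex) d ())" if g: "g \<in> carrier G" for g
  proof -
    have "\<rho> (inv\<^bsub>G\<^esub> g) * \<rho> g = 1\<^sub>m d" "\<rho> g * \<rho> (inv\<^bsub>G\<^esub> g) = 1\<^sub>m d"
      using mult[of "inv\<^bsub>G\<^esub> g" g] mult[of g "inv\<^bsub>G\<^esub> g"] one g by simp_all
    then show ?thesis using car g by (auto simp: Units_def ring_mat_simps)
  qed
  then show ?thesis
    using mult by (auto simp: representation_def hom_def units_of_def ring_mat_simps)
qed

lemma irreducible_representationD:
  assumes "irreducible_representation G d \<rho>"
    "W \<subseteq> carrier_vec d" "0\<^sub>v d \<in> W" "\<And>v w. v \<in> W \<Longrightarrow> w \<in> W \<Longrightarrow> v + w \<in> W"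
    "\<And>c v. v \<in> W \<Longrightarrow> c \<cdot>\<^sub>v v \<in> W"
    "\<And>g w. g \<in> carrier G \<Longrightarrow> w \<in> W \<Longrightarrow> \<rho> g *\<^sub>v w \<in> W"
  shows "W = {0\<^sub>v d} \<or> W = carrier_vec d"
  using assms subspace_vecI[OF assms(2-5)] unfolding irreducible_representation_def by blast

text \<open>One half of Schur's lemma: the kernel of an intertwiner is invariant under \<sigma>. The
  other half, \<open>intertwiner_image\<close>, is that its image is invariant under \<rho>.\<close>

lemma intertwiner_kernel:
  assumes \<sigma>: "irreducible_representation G e \<sigma>" and B: "B \<in> carrier_mat d e"
    and \<rho>: "\<And>g. g \<in> carrier G \<Longrightarrow> \<rho> g \<in> carrier_mat d d"
    and eq: "\<And>g. g \<in> carrier G \<Longrightarrow> \<rho> g * B = B * \<sigma> g"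
  shows "mat_kernel B = {0\<^sub>v e} \<or> mat_kernel B = carrier_vec e"
proof (rule irreducible_representationD[OF \<sigma>])
  have \<sigma>': "\<sigma> g \<in> carrier_mat e e" if "g \<in> carrier G" for g
    using \<sigma> that representation_carrier by (auto simp: irreducible_representation_def)
  show "mat_kernel B \<subseteq> carrier_vec e" "0\<^sub>v e \<in> mat_kernel B" using B by (auto simp: mat_kernel)
  show "v + w \<in> mat_kernel B" if "v \<in> mat_kernel B" "w \<in> mat_kernel B" for v w
    using that B by (auto simp: mat_kernel mult_add_distrib_mat_vec)
  show "c \<cdot>\<^sub>v v \<in> mat_kernel B" if "v \<in> mat_kernel B" for c v
    using that B by (auto simp: mat_kernel mult_mat_vec)
  fix g w assume g: "g \<in> carrier G" and w: "w \<in> mat_kernel B"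
  then have w': "w \<in> carrier_vec e" "B *\<^sub>v w = 0\<^sub>v d" using B by (auto simp: mat_kernel)
  have "B *\<^sub>v (\<sigma> g *\<^sub>v w) = (B * \<sigma> g) *\<^sub>v w" using B \<sigma>'[OF g] w' by simp
  also have "\<dots> = \<rho> g *\<^sub>v (B *\<^sub>v w)" using eq[OF g] B \<rho>[OF g] w' by (metis assoc_mult_mat_vec)
  also have "\<dots> = 0\<^sub>v d" using w' \<rho>[OF g] by (auto intro!: eq_vecI)
  finally show "\<sigma> g *\<^sub>v w \<in> mat_kernel B" using B \<sigma>'[OF g] w' by (auto simp: mat_kernel)
qed

lemma intertwiner_image:
  assumes \<rho>: "irreducible_representation G d \<rho>" and B: "B \<in> carrier_mat d e"
    and \<sigma>: "\<And>g. g \<in> carrier G \<Longrightarrow> \<sigma> g \<in> carrier_mat e e"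
    and eq: "\<And>g. g \<in> carrier G \<Longrightarrow> \<rho> g * B = B * \<sigma> g"
  shows "(*\<^sub>v) B ` carrier_vec e = {0\<^sub>v d} \<or> (*\<^sub>v) B ` carrier_vec e = carrier_vec d"
proof (rule irreducible_representationD[OF \<rho>])
  have \<rho>': "\<rho> g \<in> carrier_mat d d" if "g \<in> carrier G" for g
    using \<rho> that representation_carrier by (auto simp: irreducible_representation_def)
  show "(*\<^sub>v) B ` carrier_vec e \<subseteq> carrier_vec d" using B by auto
  show "0\<^sub>v d \<in> (*\<^sub>v) B ` carrier_vec e"
    using B by (intro image_eqI[of _ _ "0\<^sub>v e"]) auto
  show "v + w \<in> (*\<^sub>v) B ` carrier_vec e" if vw: "v \<in> (*\<^sub>v) B ` carrier_vec e" "w \<in> (*\<^sub>v) B ` carrier_vec e" for v w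
  proof -
    obtain v' w' where "v = B *\<^sub>v v'" "w = B *\<^sub>v w'" "v' \<in> carrier_vec e" "w' \<in> carrier_vec e" using vw by blast
    then show ?thesis using B by (intro image_eqI[of _ _ "v' + w'"]) (auto simp: mult_add_distrib_mat_vec)
  qed
  show "c \<cdot>\<^sub>v v \<in> (*\<^sub>v) B ` carrier_vec e" if v: "v \<in> (*\<^sub>v) B ` carrier_vec e" for c v
  proof -
    obtain v' where "v = B *\<^sub>v v'" "v' \<in> carrier_vec e" using v by blast
    then show ?thesis using B by (intro image_eqI[of _ _ "c \<cdot>\<^sub>v v'"]) (auto simp: mult_mat_vec)
  qed
  fix g w assume g: "g \<in> carrier G" and w: "w \<in> (*\<^sub>v) B ` carrier_vec e"
  then obtain v where v: "w = B *\<^sub>v v" "v \<in> carrier_vec e" by auto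
  have "\<rho> g *\<^sub>v w = (\<rho> g * B) *\<^sub>v v" using B \<rho>'[OF g] v by simp
  also have "\<dots> = B *\<^sub>v (\<sigma> g *\<^sub>v v)" using eq[OF g] B \<sigma>[OF g] v by (metis assoc_mult_mat_vec)
  finally show "\<rho> g *\<^sub>v w \<in> (*\<^sub>v) B ` carrier_vec e" using \<sigma>[OF g] v by auto
qed

lemma mat_eq_0_of_mult_vec:
  fixes B :: "complex mat"
  assumes B: "B \<in> carrier_mat d e" and "\<And>v. v \<in> carrier_vec e \<Longrightarrow> B *\<^sub>v v = 0\<^sub>v d"
  shows "B = 0\<^sub>m d e"
proof (rule eq_matI)
  fix i j assume ij: "i < dim_row (0\<^sub>m d e :: complex mat)" "j < dim_col (0\<^sub>m d e :: complex mat)"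
  have "col B j = B *\<^sub>v unit_vec e j" using B ij by (auto intro!: eq_vecI)
  also have "\<dots> = 0\<^sub>v d" using assms(2) by simp
  finally have "col B j $ i = 0" using ij by simp
  then show "B $$ (i, j) = 0\<^sub>m d e $$ (i, j)" using B ij by simp
qed (use B in auto)

text \<open>A nonzero intertwiner has zero kernel and full image, hence a two-sided inverse C. The
  traces are compared through the rectangular matrices B and C, which avoids a separate proof of d =
  e.\<close>

lemma intertwiner_characters_eq:
  assumes \<rho>: "irreducible_representation G d \<rho>" and \<sigma>: "irreducible_representation G e \<sigma>"
    and B: "B \<in> carrier_mat d e" "B \<noteq> 0\<^sub>m d e"
    and eq: "\<And>g. g \<in> carrier G \<Longrightarrow> \<rho> g * B = B * \<sigma> g"
    and g: "g \<in> carrier G"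
  shows "(\<Sum>i<d. \<rho> g $$ (i, i)) = (\<Sum>i<e. \<sigma> g $$ (i, i))"
proof -
  have \<rho>': "\<rho> g \<in> carrier_mat d d" if "g \<in> carrier G" for g
    using \<rho> that representation_carrier by (auto simp: irreducible_representation_def)
  have \<sigma>': "\<sigma> g \<in> carrier_mat e e" if "g \<in> carrier G" for g
    using \<sigma> that representation_carrier by (auto simp: irreducible_representation_def)
  have ker: "mat_kernel B = {0\<^sub>v e}"
    using intertwiner_kernel[OF \<sigma> B(1) \<rho>' eq] mat_eq_0_of_mult_vec[OF B(1)] B by (auto simp: mat_kernel)
  have img: "(*\<^sub>v) B ` carrier_vec e = carrier_vec d"
  proof (rule ccontr)
    assume "\<not> ?thesis"
    then have "(*\<^sub>v) B ` carrier_vec e = {0\<^sub>v d}" using intertwiner_image[OF \<rho> B(1) \<sigma>' eq] by blast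
    then have "B = 0\<^sub>m d e" by (intro mat_eq_0_of_mult_vec[OF B(1)]) blast
    then show False using B by blast
  qed
  have "\<exists>v. v \<in> carrier_vec e \<and> B *\<^sub>v v = unit_vec d i" for i
  proof -
    have "unit_vec d i \<in> (*\<^sub>v) B ` carrier_vec e" unfolding img by simp
    then show ?thesis by auto
  qed
  then obtain v where v: "\<And>i. v i \<in> carrier_vec e" "\<And>i. B *\<^sub>v v i = unit_vec d i" by metis
  \<comment> \<open>The columns are preimages under B of the unit vectors, which makes C a right
    inverse.\<close>
  define C where "C = mat e d (\<lambda>(i, j). v j $ i)"
  have C: "C \<in> carrier_mat e d" by (simp add: C_def)
  have colC: "col C j = v j" if "j < d" for j
    using that v(1)[of j] by (auto simp: C_def)
  have BC: "B * C = 1\<^sub>m d"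
  proof (rule eq_matI)
    fix i j assume ij: "i < dim_row (1\<^sub>m d :: complex mat)" "j < dim_col (1\<^sub>m d :: complex mat)"
    have "(B * C) $$ (i, j) = (B *\<^sub>v v j) $ i" using B C ij colC by simp
    then show "(B * C) $$ (i, j) = 1\<^sub>m d $$ (i, j)" using v(2) ij by simp
  qed (use B C in auto)
  have CB: "C * B = 1\<^sub>m e"
  proof -
    \<comment> \<open>From B C = 1 the matrix C B - 1 is annihilated by B, so its image lies in the
      zero kernel and it vanishes.\<close>
    have "B * (C * B - 1\<^sub>m e) = B * (C * B) - B" using B C by (subst mult_minus_distrib_mat) auto
    also have "B * (C * B) = B" using B C BC by (simp flip: assoc_mult_mat)
    finally have z: "B * (C * B - 1\<^sub>m e) = 0\<^sub>m d e" using B by auto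
    have "C * B - 1\<^sub>m e = 0\<^sub>m e e"
    proof (rule mat_eq_0_of_mult_vec)
      fix w :: "complex vec" assume w: "w \<in> carrier_vec e"
      have "B *\<^sub>v ((C * B - 1\<^sub>m e) *\<^sub>v w) = 0\<^sub>m d e *\<^sub>v w"
        using B C w unfolding z[symmetric] by (subst assoc_mult_mat_vec) auto
      also have "\<dots> = 0\<^sub>v d" using w by (auto intro!: eq_vecI)
      finally have "(C * B - 1\<^sub>m e) *\<^sub>v w \<in> mat_kernel B"
        using B C w by (auto simp: mat_kernel intro!: mult_mat_vec_carrier minus_carrier_mat)
      then show "(C * B - 1\<^sub>m e) *\<^sub>v w = 0\<^sub>v e" using ker by blast
    qed (use B C in auto)
    then have "(C * B - 1\<^sub>m e) $$ (i, j) = 0" if "i < e" "j < e" for i j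
      using that by simp
    then show ?thesis using B C by (intro eq_matI) auto
  qed
  have "\<sigma> g = (C * B) * \<sigma> g" using CB \<sigma>'[OF g] by simp
  also have "\<dots> = C * (\<rho> g * B)" using B C \<sigma>'[OF g] eq[OF g] by simp
  finally have "(\<Sum>i<e. \<sigma> g $$ (i, i)) = (\<Sum>i<e. (C * (\<rho> g * B)) $$ (i, i))" by simp
  also have "\<dots> = (\<Sum>i<d. ((\<rho> g * B) * C) $$ (i, i))" using B C \<rho>'[OF g] by (intro trace_mult_comm) auto
  also have "(\<rho> g * B) * C = \<rho> g" using B(1) C \<rho>'[OF g] BC by simp
  finally show ?thesis by simp
qed

text \<open>The average of \<open>\<rho> g E \<sigma> (g\<inverse>)\<close> for the matrix unit \<open>E\<close> at position \<open>(i, j)\<close>, up to the factor $|G|$.\<close>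

definition averaged_unit :: "('g, 'b) monoid_scheme \<Rightarrow> nat \<Rightarrow> nat \<Rightarrow> ('g \<Rightarrow> complex mat) \<Rightarrow> ('g \<Rightarrow> complex mat) \<Rightarrow> nat \<Rightarrow> nat \<Rightarrow> complex mat" where
  "averaged_unit G d e \<rho> \<sigma> i j =
     mat d e (\<lambda>(a, b). \<Sum>g\<in>carrier G. \<rho> g $$ (a, i) * \<sigma> (inv\<^bsub>G\<^esub> g) $$ (j, b))"

lemma averaged_unit_carrier: "averaged_unit G d e \<rho> \<sigma> i j \<in> carrier_mat d e"
  by (simp add: averaged_unit_def)

lemma averaged_unit_intertwines:
  assumes G: "group G" and \<rho>: "representation G d \<rho>" and \<sigma>: "representation G e \<sigma>"
    and ij: "i < d" "j < e" and h: "h \<in> carrier G"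
  shows "\<rho> h * averaged_unit G d e \<rho> \<sigma> i j = averaged_unit G d e \<rho> \<sigma> i j * \<sigma> h"
proof (rule eq_matI)
  interpret group G by (rule G)
  let ?B = "averaged_unit G d e \<rho> \<sigma> i j"
  note \<rho>' = representation_carrier[OF \<rho>] and \<sigma>' = representation_carrier[OF \<sigma>]
  fix a b assume "a < dim_row (?B * \<sigma> h)" "b < dim_col (?B * \<sigma> h)"
  then have ab: "a < d" "b < e" using \<sigma>'[OF h] by (auto simp: averaged_unit_def)
  have "(\<rho> h * ?B) $$ (a, b) = (\<Sum>c<d. \<rho> h $$ (a, c) * (\<Sum>g\<in>carrier G. \<rho> g $$ (c, i) * \<sigma> (inv\<^bsub>G\<^esub> g) $$ (j, b)))"
    using ab by (simp add: mult_mat_entry[OF \<rho>'[OF h] averaged_unit_carrier]) (simp add: averaged_unit_def)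
  also have "\<dots> = (\<Sum>g\<in>carrier G. (\<Sum>c<d. \<rho> h $$ (a, c) * \<rho> g $$ (c, i)) * \<sigma> (inv\<^bsub>G\<^esub> g) $$ (j, b))"
    unfolding sum_distrib_left sum_distrib_right by (subst sum.swap) (simp add: mult.assoc)
  also have "\<dots> = (\<Sum>g\<in>carrier G. \<rho> (h \<otimes>\<^bsub>G\<^esub> g) $$ (a, i) * \<sigma> (inv\<^bsub>G\<^esub> g) $$ (j, b))"
    using ab ij h by (intro sum.cong refl) (simp add: representation_mult[OF \<rho>] mult_mat_entry[OF \<rho>' \<rho>'])
  \<comment> \<open>Substituting h g for g on the right turns the inverse of g, times h, into the
    inverse of g.\<close>
  also have "\<dots> = (\<Sum>g\<in>carrier G. \<rho> g $$ (a, i) * \<sigma> (inv\<^bsub>G\<^esub> g \<otimes>\<^bsub>G\<^esub> h) $$ (j, b))"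
  proof (rule sum.reindex_bij_witness[of _ "\<lambda>g. inv\<^bsub>G\<^esub> h \<otimes>\<^bsub>G\<^esub> g" "\<lambda>g. h \<otimes>\<^bsub>G\<^esub> g"])
    fix g assume g: "g \<in> carrier G"
    show "inv\<^bsub>G\<^esub> h \<otimes>\<^bsub>G\<^esub> (h \<otimes>\<^bsub>G\<^esub> g) = g" "h \<otimes>\<^bsub>G\<^esub> (inv\<^bsub>G\<^esub> h \<otimes>\<^bsub>G\<^esub> g) = g"
      using g h by (simp_all add: m_assoc[symmetric])
    show "\<rho> (h \<otimes>\<^bsub>G\<^esub> g) $$ (a, i) * \<sigma> (inv\<^bsub>G\<^esub> (h \<otimes>\<^bsub>G\<^esub> g) \<otimes>\<^bsub>G\<^esub> h) $$ (j, b)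
        = \<rho> (h \<otimes>\<^bsub>G\<^esub> g) $$ (a, i) * \<sigma> (inv\<^bsub>G\<^esub> g) $$ (j, b)"
      using g h by (simp add: inv_mult_group m_assoc)
  qed (use h in auto)
  also have "\<dots> = (\<Sum>g\<in>carrier G. \<rho> g $$ (a, i) * (\<Sum>c<e. \<sigma> (inv\<^bsub>G\<^esub> g) $$ (j, c) * \<sigma> h $$ (c, b)))"
    using ab ij h by (intro sum.cong refl) (simp add: representation_mult[OF \<sigma>] mult_mat_entry[OF \<sigma>' \<sigma>'])
  also have "\<dots> = (\<Sum>c<e. (\<Sum>g\<in>carrier G. \<rho> g $$ (a, i) * \<sigma> (inv\<^bsub>G\<^esub> g) $$ (j, c)) * \<sigma> h $$ (c, b))"
    unfolding sum_distrib_left sum_distrib_right by (subst sum.swap) (simp add: mult.assoc)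
  also have "\<dots> = (?B * \<sigma> h) $$ (a, b)"
    using ab by (simp add: mult_mat_entry[OF averaged_unit_carrier \<sigma>'[OF h]]) (simp add: averaged_unit_def)
  finally show "(\<rho> h * ?B) $$ (a, b) = (?B * \<sigma> h) $$ (a, b)" .
qed (use representation_carrier[OF \<rho> h] representation_carrier[OF \<sigma> h] in \<open>auto simp: averaged_unit_def\<close>)

text \<open>Expanding the product of the two traces reduces both orthogonality relations to single
  entries of averaged matrix units, to which Schur's lemma applies.\<close>

lemma sum_characters:
  assumes "affords G d \<rho> \<chi>" "affords G e \<sigma> \<psi>" "group G"
  shows "(\<Sum>g\<in>carrier G. \<chi> g * \<psi> (inv\<^bsub>G\<^esub> g)) =
    (\<Sum>i<d. \<Sum>j<e. averaged_unit G d e \<rho> \<sigma> i j $$ (i, j))"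
proof -
  have "(\<Sum>g\<in>carrier G. \<chi> g * \<psi> (inv\<^bsub>G\<^esub> g)) =
      (\<Sum>g\<in>carrier G. \<Sum>i<d. \<Sum>j<e. \<rho> g $$ (i, i) * \<sigma> (inv\<^bsub>G\<^esub> g) $$ (j, j))"
    using assms by (simp add: affords_def sum_product group.inv_closed)
  also have "\<dots> = (\<Sum>i<d. \<Sum>g\<in>carrier G. \<Sum>j<e. \<rho> g $$ (i, i) * \<sigma> (inv\<^bsub>G\<^esub> g) $$ (j, j))"
    by (rule sum.swap)
  also have "\<dots> = (\<Sum>i<d. \<Sum>j<e. \<Sum>g\<in>carrier G. \<rho> g $$ (i, i) * \<sigma> (inv\<^bsub>G\<^esub> g) $$ (j, j))"
    by (intro sum.cong refl sum.swap)
  finally show ?thesis by (simp add: averaged_unit_def)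
qed

text \<open>A nonzero averaged unit would be an intertwiner and force equal characters. The pairing
  uses the value at the inverse instead of a complex conjugate, which spares any discussion of
  unitarity.\<close>

lemma irreducible_characters_orthogonal:
  assumes G: "group G" and \<chi>: "is_irreducible_character G \<chi>" and \<psi>: "is_irreducible_character G \<psi>"
    and ne: "h \<in> carrier G" "\<chi> h \<noteq> \<psi> h"
  shows "(\<Sum>g\<in>carrier G. \<chi> g * \<psi> (inv\<^bsub>G\<^esub> g)) = 0"
proof -
  obtain d \<rho> where \<rho>: "irreducible_representation G d \<rho>" "affords G d \<rho> \<chi>"
    using \<chi> by (auto simp: is_irreducible_character_def)
  obtain e \<sigma> where \<sigma>: "irreducible_representation G e \<sigma>" "affords G e \<sigma> \<psi>"
    using \<psi> by (auto simp: is_irreducible_character_def)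
  have rep: "representation G d \<rho>" "representation G e \<sigma>"
    using \<rho> \<sigma> by (auto simp: irreducible_representation_def)
  have "averaged_unit G d e \<rho> \<sigma> i j = 0\<^sub>m d e" if "i < d" "j < e" for i j
  proof (rule ccontr)
    assume "averaged_unit G d e \<rho> \<sigma> i j \<noteq> 0\<^sub>m d e"
    then have "(\<Sum>i<d. \<rho> h $$ (i, i)) = (\<Sum>i<e. \<sigma> h $$ (i, i))"
      using averaged_unit_intertwines[OF G rep that] ne(1)
      by (rule intertwiner_characters_eq[OF \<rho>(1) \<sigma>(1) averaged_unit_carrier])
    then show False using ne \<rho>(2) \<sigma>(2) by (simp add: affords_def)
  qed
  then show ?thesis by (simp add: sum_characters[OF \<rho>(2) \<sigma>(2) G])
qed

text \<open>B has an eigenvalue c over the complex numbers. The matrix B - c 1 is again an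
  intertwiner, with nonzero kernel, so by irreducibility its kernel is everything.\<close>

lemma self_intertwiner_scalar:
  assumes \<rho>: "irreducible_representation G d \<rho>" and B: "B \<in> carrier_mat d d"
    and eq: "\<And>g. g \<in> carrier G \<Longrightarrow> \<rho> g * B = B * \<rho> g"
  obtains c where "B = c \<cdot>\<^sub>m 1\<^sub>m d"
proof -
  have d: "d > 0" and \<rho>': "\<And>g. g \<in> carrier G \<Longrightarrow> \<rho> g \<in> carrier_mat d d"
    using \<rho> representation_carrier by (auto simp: irreducible_representation_def)
  obtain c v where v: "v \<in> carrier_vec d" "v \<noteq> 0\<^sub>v d" "B *\<^sub>v v = c \<cdot>\<^sub>v v"
    using spectrum_non_empty[OF B d] B by (auto simp: spectrum_def eigenvalue_def eigenvector_def)
  define A where "A = B - c \<cdot>\<^sub>m 1\<^sub>m d"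
  have A: "A \<in> carrier_mat d d" using B unfolding A_def by (intro minus_carrier_mat) simp
  have smult_one: "(c \<cdot>\<^sub>m 1\<^sub>m d) *\<^sub>v w = c \<cdot>\<^sub>v w" if "w \<in> carrier_vec d" for w
    using that by (auto intro!: eq_vecI)
  have comm: "\<rho> g * A = A * \<rho> g" if g: "g \<in> carrier G" for g
  proof -
    have "\<rho> g * A = \<rho> g * B - \<rho> g * (c \<cdot>\<^sub>m 1\<^sub>m d)"
      unfolding A_def using B \<rho>'[OF g] by (intro mult_minus_distrib_mat) auto
    also have "\<rho> g * (c \<cdot>\<^sub>m 1\<^sub>m d) = c \<cdot>\<^sub>m \<rho> g"
      using \<rho>'[OF g] mult_smult_distrib[OF \<rho>'[OF g], of "1\<^sub>m d" d c] by simp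
    also have "c \<cdot>\<^sub>m \<rho> g = (c \<cdot>\<^sub>m 1\<^sub>m d) * \<rho> g"
      using \<rho>'[OF g] mult_smult_assoc_mat[of "1\<^sub>m d" d d "\<rho> g" d c] by simp
    also have "\<rho> g * B - (c \<cdot>\<^sub>m 1\<^sub>m d) * \<rho> g = A * \<rho> g"
      unfolding A_def eq[OF g] using B \<rho>'[OF g] by (intro minus_mult_distrib_mat[symmetric]) auto
    finally show ?thesis .
  qed
  have "mat_kernel A = {0\<^sub>v d} \<or> mat_kernel A = carrier_vec d"
    by (rule intertwiner_kernel[OF \<rho> A \<rho>' comm])
  moreover have "v \<in> mat_kernel A"
    using A B v smult_one by (auto simp: mat_kernel A_def minus_mult_distrib_mat_vec)
  ultimately have "A = 0\<^sub>m d d" using v A by (intro mat_eq_0_of_mult_vec[OF A]) (auto simp: mat_kernel)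
  then have "(B - c \<cdot>\<^sub>m 1\<^sub>m d) $$ (i, j) = 0" if "i < d" "j < d" for i j
    using that by (simp add: A_def)
  then have "B = c \<cdot>\<^sub>m 1\<^sub>m d" using B by (intro eq_matI) auto
  then show ?thesis by (rule that)
qed

lemma irreducible_character_norm:
  assumes G: "group G" and \<chi>: "is_irreducible_character G \<chi>"
  shows "(\<Sum>g\<in>carrier G. \<chi> g * \<chi> (inv\<^bsub>G\<^esub> g)) = of_nat (card (carrier G))"
proof -
  interpret group G by (rule G)
  obtain d \<rho> where \<rho>: "irreducible_representation G d \<rho>" "affords G d \<rho> \<chi>"
    using \<chi> by (auto simp: is_irreducible_character_def)
  then have d: "d > 0" and rep: "representation G d \<rho>" by (auto simp: irreducible_representation_def)
  let ?B = "averaged_unit G d d \<rho> \<rho>"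
  let ?n = "of_nat (card (carrier G)) :: complex"
  have entry: "?B i j $$ (i, j) = (if i = j then ?n / of_nat d else 0)" if ij: "i < d" "j < d" for i j
  proof -
    obtain c where c: "?B i j = c \<cdot>\<^sub>m 1\<^sub>m d"
      using averaged_unit_intertwines[OF G rep rep ij]
      by (rule self_intertwiner_scalar[OF \<rho>(1) averaged_unit_carrier])
    \<comment> \<open>The scalar is found by taking the trace: cyclically, each g contributes the
      (j, i) entry of the identity matrix.\<close>
    have "of_nat d * c = (\<Sum>a<d. ?B i j $$ (a, a))" by (simp add: c)
    also have "\<dots> = (\<Sum>g\<in>carrier G. \<Sum>a<d. \<rho> (inv\<^bsub>G\<^esub> g) $$ (j, a) * \<rho> g $$ (a, i))"
      by (simp add: averaged_unit_def mult.commute) (rule sum.swap)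
    also have "\<dots> = (\<Sum>g\<in>carrier G. (\<rho> (inv\<^bsub>G\<^esub> g) * \<rho> g) $$ (j, i))"
      using ij by (intro sum.cong refl) (simp add: mult_mat_entry[OF representation_carrier[OF rep] representation_carrier[OF rep]])
    also have "\<dots> = (\<Sum>g\<in>carrier G. 1\<^sub>m d $$ (j, i))"
      by (intro sum.cong refl) (simp add: representation_mult[OF rep, symmetric] representation_one[OF rep G])
    also have "\<dots> = (if i = j then ?n else 0)" using ij by simp
    finally have "c = (if i = j then ?n / of_nat d else 0)" using d by (auto simp: field_simps split: if_splits)
    then show ?thesis using ij by (simp add: c)
  qed
  have "(\<Sum>g\<in>carrier G. \<chi> g * \<chi> (inv\<^bsub>G\<^esub> g)) = (\<Sum>i<d. \<Sum>j<d. ?B i j $$ (i, j))"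
    by (rule sum_characters[OF \<rho>(2) \<rho>(2) G])
  also have "\<dots> = (\<Sum>i<d. \<Sum>j<d. if i = j then ?n / of_nat d else 0)" by (simp add: entry)
  also have "\<dots> = ?n" using d by simp
  finally show ?thesis .
qed

section \<open>Sums of characters, and characters as class functions\<close>

lemma is_character_zero:
  assumes G: "group G"
  shows "is_character G (\<lambda>_. 0)"
proof -
  have "representation G 0 (\<lambda>_. 1\<^sub>m 0)" by (rule representationI[OF G]) auto
  then show ?thesis unfolding is_character_def affords_def by (intro exI conjI) auto
qed

lemma is_character_add:
  assumes G: "group G" and "is_character G \<chi>" "is_character G \<psi>"
  shows "is_character G (\<lambda>g. \<chi> g + \<psi> g)"
proof -
  interpret group G by (rule G)
  obtain d \<rho> where \<rho>: "representation G d \<rho>" "affords G d \<rho> \<chi>" using assms by (auto simp: is_character_def)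
  obtain e \<sigma> where \<sigma>: "representation G e \<sigma>" "affords G e \<sigma> \<psi>" using assms by (auto simp: is_character_def)
  note \<rho>' = representation_carrier[OF \<rho>(1)] and \<sigma>' = representation_carrier[OF \<sigma>(1)]
  define \<tau> where "\<tau> g = four_block_mat (\<rho> g) (0\<^sub>m d e) (0\<^sub>m e d) (\<sigma> g)" for g
  have "representation G (d + e) \<tau>"
  proof (rule representationI[OF G])
    show "\<tau> g \<in> carrier_mat (d + e) (d + e)" if "g \<in> carrier G" for g
      unfolding \<tau>_def by (rule four_block_carrier_mat[OF \<rho>'[OF that] \<sigma>'[OF that]])
    show "\<tau> (g \<otimes>\<^bsub>G\<^esub> h) = \<tau> g * \<tau> h" if "g \<in> carrier G" "h \<in> carrier G" for g h
      unfolding \<tau>_def representation_mult[OF \<rho>(1) that] representation_mult[OF \<sigma>(1) that]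
      using \<rho>'[OF that(1)] \<rho>'[OF that(2)] \<sigma>'[OF that(1)] \<sigma>'[OF that(2)]
      by (subst mult_four_block_mat[of _ d d _ e _ e _ _ d _ e]) auto
    show "\<tau> \<one>\<^bsub>G\<^esub> = 1\<^sub>m (d + e)"
      by (simp add: \<tau>_def representation_one[OF \<rho>(1) G] representation_one[OF \<sigma>(1) G])
  qed
  moreover have "affords G (d + e) \<tau> (\<lambda>g. \<chi> g + \<psi> g)"
    unfolding affords_def
  proof
    fix g assume g: "g \<in> carrier G"
    have "(\<Sum>i<d + e. \<tau> g $$ (i, i)) = (\<Sum>i<d. \<tau> g $$ (i, i)) + (\<Sum>i<e. \<tau> g $$ (d + i, d + i))"
      using sum.nat_group[of "\<lambda>i. \<tau> g $$ (i, i)" d] sum.atLeastLessThan_concat[of 0 d "d + e" "\<lambda>i. \<tau> g $$ (i, i)"]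
        sum.shift_bounds_nat_ivl[of "\<lambda>i. \<tau> g $$ (i, i)" 0 d e]
      by (simp add: atLeast0LessThan add.commute)
    also have "\<dots> = \<chi> g + \<psi> g"
      using \<rho>'[OF g] \<sigma>'[OF g] \<rho>(2) \<sigma>(2) g by (simp add: \<tau>_def affords_def)
    finally show "\<chi> g + \<psi> g = (\<Sum>i<d + e. \<tau> g $$ (i, i))" by simp
  qed
  ultimately show ?thesis unfolding is_character_def by blast
qed

lemma is_character_of_nat_mult:
  assumes "group G" "is_character G \<chi>"
  shows "is_character G (\<lambda>g. of_nat m * \<chi> g)"
proof (induction m)
  case (Suc m)
  then show ?case using is_character_add[OF assms(1) assms(2) Suc] by (simp add: ring_distribs)
qed (simp add: is_character_zero assms)

lemma is_character_sum:
  assumes G: "group G" and fin: "finite I" and \<chi>: "\<And>i. i \<in> I \<Longrightarrow> is_character G (\<chi> i)"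
  shows "is_character G (\<lambda>g. \<Sum>i\<in>I. \<chi> i g)"
  using fin \<chi> by (induction I rule: finite_induct) (simp_all add: is_character_zero is_character_add G)

lemma irreducible_character_is_character: "is_irreducible_character G \<chi> \<Longrightarrow> is_character G \<chi>"
  unfolding is_irreducible_character_def is_character_def irreducible_representation_def by blast

lemma character_conjugate:
  assumes G: "group G" and \<chi>: "is_character G \<chi>" and g: "g \<in> carrier G" and h: "h \<in> carrier G"
  shows "\<chi> (h \<otimes>\<^bsub>G\<^esub> g \<otimes>\<^bsub>G\<^esub> inv\<^bsub>G\<^esub> h) = \<chi> g"
proof -
  interpret group G by (rule G)
  obtain d \<rho> where \<rho>: "representation G d \<rho>" and aff: "affords G d \<rho> \<chi>" using \<chi> by (auto simp: is_character_def)
  note \<rho>' = representation_carrier[OF \<rho>]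
  have "\<chi> (h \<otimes>\<^bsub>G\<^esub> g \<otimes>\<^bsub>G\<^esub> inv\<^bsub>G\<^esub> h) = (\<Sum>i<d. (\<rho> (h \<otimes>\<^bsub>G\<^esub> g) * \<rho> (inv\<^bsub>G\<^esub> h)) $$ (i, i))"
    using aff g h by (simp add: affords_def flip: representation_mult[OF \<rho>])
  also have "\<dots> = (\<Sum>i<d. (\<rho> (inv\<^bsub>G\<^esub> h) * \<rho> (h \<otimes>\<^bsub>G\<^esub> g)) $$ (i, i))"
    using g h by (intro trace_mult_comm[of _ d d]) (auto intro: \<rho>')
  also have "\<dots> = \<chi> g"
    using aff g h by (simp add: affords_def m_assoc[symmetric] flip: representation_mult[OF \<rho>])
  finally show ?thesis .
qed

section \<open>Cycle types and conjugacy\<close>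

text \<open>Lets the divisibility facts about \<open>least_power\<close> speak about orbit
  sizes.\<close>

lemma card_orbit_permutation:
  assumes "permutation p"
  shows "card (orbit p a) = least_power p a"
proof -
  have "orbit p a = set (support p a)"
    using support_set[OF assms, of a] orbit_altdef_permutation[OF assms, of a] by auto
  then show ?thesis
    using distinct_card[OF cycle_of_permutation[OF assms, of a]] by simp
qed

text \<open>Cancelling the injective smaller power leaves the question whether the power with
  exponent j - i fixes a, that is, whether the orbit size divides j - i.\<close>

lemma funpow_eq_iff_cong_orbit:
  assumes p: "permutation p"
  shows "(p ^^ i) a = (p ^^ j) a \<longleftrightarrow> i mod card (orbit p a) = j mod card (orbit p a)"
proof -
  have *: "(p ^^ i) a = (p ^^ j) a \<longleftrightarrow> i mod card (orbit p a) = j mod card (orbit p a)" if "i \<le> j" for i j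
  proof -
    have "inj (p ^^ i)" using p by (simp add: permutation_bijective bij_is_inj inj_fn)
    moreover have "(p ^^ j) a = (p ^^ i) ((p ^^ (j - i)) a)"
      using that by (simp flip: funpow_add comp_apply[of "p ^^ i"])
    ultimately have "(p ^^ i) a = (p ^^ j) a \<longleftrightarrow> a = (p ^^ (j - i)) a" by (simp add: inj_eq)
    also have "\<dots> \<longleftrightarrow> card (orbit p a) dvd j - i"
      using least_power_dvd[OF p] by (metis card_orbit_permutation[OF p])
    also have "\<dots> \<longleftrightarrow> i mod card (orbit p a) = j mod card (orbit p a)"
      using mod_eq_dvd_iff_nat[OF that] by metis
    finally show ?thesis .
  qed
  show ?thesis using *[of i j] *[of j i] by (cases "i \<le> j") auto
qed

text \<open>Serves to pair the orbits of two permutations so that paired orbits have equal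
  size.\<close>

lemma bij_betw_of_image_mset_eq:
  assumes "finite A" "finite B" "image_mset f (mset_set A) = image_mset g (mset_set B)"
  obtains \<phi> where "bij_betw \<phi> A B" "\<And>a. a \<in> A \<Longrightarrow> g (\<phi> a) = f a"
proof -
  have "\<exists>\<phi>. bij_betw \<phi> A B \<and> (\<forall>a\<in>A. g (\<phi> a) = f a)"
    using assms
  proof (induction A arbitrary: B rule: finite_induct)
    case empty
    then have "B = {}" by (simp add: mset_set_empty_iff)
    then show ?case by (simp add: bij_betw_def)
  next
    case (insert a A)
    have "f a \<in># image_mset g (mset_set B)" using insert by (simp flip: insert.prems(2))
    then obtain b where b: "b \<in> B" "g b = f a" using insert.prems(1) by auto
    then have "mset_set B = add_mset b (mset_set (B - {b}))"
      using insert.prems(1) by (simp add: mset_set.remove)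
    then have "image_mset f (mset_set A) = image_mset g (mset_set (B - {b}))"
      using insert b by simp
    then obtain \<phi> where \<phi>: "bij_betw \<phi> A (B - {b})" "\<forall>a\<in>A. g (\<phi> a) = f a"
      using insert.IH[of "B - {b}"] insert.prems(1) by auto
    have "bij_betw (\<phi>(a := b)) (insert a A) (insert b (B - {b}))"
    proof -
      have "bij_betw (\<phi>(a := b)) A (B - {b})"
        using \<phi>(1) insert.hyps by (subst bij_betw_cong[of A _ \<phi>]) auto
      then show ?thesis using insert.hyps by (auto simp: bij_betw_def)
    qed
    then have "bij_betw (\<phi>(a := b)) (insert a A) B" using b by (simp add: insert_absorb)
    moreover have "\<forall>x\<in>insert a A. g ((\<phi>(a := b)) x) = f x" using \<phi>(2) b by auto
    ultimately show ?case by blast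
  qed
  then show ?thesis using that by blast
qed

lemma permutes_imp_permutation: "finite S \<Longrightarrow> p permutes S \<Longrightarrow> permutation p"
  by (auto simp: permutation_permutes)

lemma orbit_eq_of_mem: "permutation p \<Longrightarrow> y \<in> orbit p x \<Longrightarrow> orbit p y = orbit p x"
  by (rule orbit_cyclic_eq3[OF cyclic_on_orbit'])

lemma conjugate_of_orbit_cards_eq:
  assumes S: "finite S" and p: "p permutes S" and q: "q permutes S"
    and eq: "image_mset card (mset_set (orbit p ` S)) = image_mset card (mset_set (orbit q ` S))"
  obtains h where "h permutes S" "q = h \<circ> p \<circ> inv' h"
proof -
  have p': "permutation p" and q': "permutation q" using S p q permutes_imp_permutation by auto
  obtain \<phi> where \<phi>: "bij_betw \<phi> (orbit p ` S) (orbit q ` S)"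
    and card_\<phi>: "\<And>X. X \<in> orbit p ` S \<Longrightarrow> card (\<phi> X) = card X"
    using bij_betw_of_image_mset_eq[OF _ _ eq] S by blast
  define base :: "'a set \<Rightarrow> 'a" where "base X = (SOME x. x \<in> X)" for X
  have base_p: "base (orbit p x) \<in> orbit p x" for x
    unfolding base_def using permutation_self_in_orbit[OF p'] by (rule someI)
  have "\<exists>i. x = (p ^^ i) (base (orbit p x))" for x
  proof -
    have "x \<in> orbit p (base (orbit p x))"
      using orbit_eq_of_mem[OF p' base_p[of x]] permutation_self_in_orbit[OF p', of x] by simp
    then show ?thesis using orbit_altdef_permutation[OF p'] by auto
  qed
  then obtain idx where idx: "\<And>x. x = (p ^^ idx x) (base (orbit p x))" by metis
  have idx_eq: "(p ^^ i) (base (orbit p x)) = (p ^^ j) (base (orbit p x)) \<longleftrightarrow>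
      i mod card (orbit p x) = j mod card (orbit p x)" for i j x
    using funpow_eq_iff_cong_orbit[OF p', of i "base (orbit p x)" j] orbit_eq_of_mem[OF p' base_p[of x]] by simp
  \<comment> \<open>The point \<open>c x\<close> depends on x only through its orbit, so it is
    unchanged when x is replaced by \<open>p x\<close>.\<close>
  define c where "c x = base (\<phi> (orbit p x))" for x
  have orbit_c: "orbit q (c x) = \<phi> (orbit p x)" if "x \<in> S" for x
  proof -
    have "\<phi> (orbit p x) \<in> orbit q ` S" using \<phi> that by (auto simp: bij_betw_def)
    then obtain y where y: "\<phi> (orbit p x) = orbit q y" by auto
    have "c x \<in> orbit q y"
      unfolding c_def y base_def using permutation_self_in_orbit[OF q'] by (rule someI)
    then show ?thesis using orbit_eq_of_mem[OF q'] y by simp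
  qed
  have c_eq: "(q ^^ i) (c x) = (q ^^ j) (c x) \<longleftrightarrow> i mod card (orbit p x) = j mod card (orbit p x)" if "x \<in> S" for i j x
    using funpow_eq_iff_cong_orbit[OF q', of i "c x" j] orbit_c[OF that] card_\<phi> that by simp
  \<comment> \<open>\<open>h\<close> matches a base point of each orbit \<open>X\<close> with a base point of \<open>\<phi> X\<close> and is extended equivariantly;
    as \<open>X\<close> and \<open>\<phi> X\<close> have the same size, the choice of the exponent \<open>idx x\<close> does not matter.\<close>
  define h where "h x = (if x \<in> S then (q ^^ idx x) (c x) else x)" for x
  have h_orbit: "h x \<in> \<phi> (orbit p x)" if "x \<in> S" for x
    using that funpow_in_orbit[OF permutation_self_in_orbit[OF q']] by (simp add: h_def flip: orbit_c[OF that])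
  have h_S: "h x \<in> S" if "x \<in> S" for x
  proof -
    have "\<phi> (orbit p x) \<in> orbit q ` S" using \<phi> that by (auto simp: bij_betw_def)
    then show ?thesis using h_orbit[OF that] permutes_orbit_subset[OF q] by blast
  qed
  have h_inj: "inj_on h S"
  proof (rule inj_onI)
    fix x y assume xy: "x \<in> S" "y \<in> S" "h x = h y"
    have "\<phi> (orbit p x) = \<phi> (orbit p y)"
      using h_orbit[OF xy(1)] h_orbit[OF xy(2)] orbit_c[OF xy(1)] orbit_c[OF xy(2)] orbit_eq_of_mem[OF q'] xy(3)
      by metis
    then have o: "orbit p x = orbit p y" using \<phi> xy by (auto simp: bij_betw_def inj_on_def)
    then have "(q ^^ idx x) (c x) = (q ^^ idx y) (c x)" using xy by (simp add: h_def c_def)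
    then have "(p ^^ idx x) (base (orbit p x)) = (p ^^ idx y) (base (orbit p x))"
      using c_eq[OF xy(1)] idx_eq by simp
    then show "x = y" using idx[of x] idx[of y] o by simp
  qed
  have "bij_betw h S S"
    using h_inj h_S S by (simp add: bij_betw_def endo_inj_surj image_subsetI)
  then have h: "h permutes S" by (rule bij_imp_permutes) (simp add: h_def)
  have "h (p x) = q (h x)" for x
  proof (cases "x \<in> S")
    case True
    have o: "orbit p (p x) = orbit p x" by (rule permutation_orbit_step[OF p'])
    have px: "p x \<in> S" using True p by (simp add: permutes_in_image)
    \<comment> \<open>The exponents \<open>idx (p x)\<close> and \<open>Suc (idx x)\<close> both
      reach \<open>p x\<close> from the base point. They agree modulo the orbit size, and the powers
      of q at \<open>c x\<close> agree as well.\<close>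
    have "(p ^^ idx (p x)) (base (orbit p x)) = p x" using idx[of "p x"] o by simp
    also have "\<dots> = (p ^^ Suc (idx x)) (base (orbit p x))" using idx[of x] by simp
    finally have "(q ^^ idx (p x)) (c x) = (q ^^ Suc (idx x)) (c x)" using c_eq[OF True] idx_eq by blast
    then show ?thesis using True px o by (simp add: h_def c_def)
  next
    case False
    then show ?thesis using p q by (simp add: h_def permutes_not_in)
  qed
  then have "q \<circ> h = h \<circ> p" by (auto simp: fun_eq_iff)
  then have "q = h \<circ> p \<circ> inv' h" using permutes_inv_o(1)[OF h] by (metis comp_assoc comp_id)
  then show ?thesis using that h by blast
qed

lemma cycle_type_conjugate:
  assumes \<sigma>: "\<sigma> \<in> carrier (sym_group n)" and \<tau>: "\<tau> \<in> carrier (sym_group n)"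
    and eq: "cycle_type n \<sigma> = cycle_type n \<tau>"
  obtains h where "h \<in> carrier (sym_group n)"
    "\<tau> = h \<otimes>\<^bsub>sym_group n\<^esub> \<sigma> \<otimes>\<^bsub>sym_group n\<^esub> inv\<^bsub>sym_group n\<^esub> h"
proof -
  have "image_mset card (mset_set (orbit \<sigma> ` {1..n})) = image_mset card (mset_set (orbit \<tau> ` {1..n}))"
    using eq unfolding cycle_type_def rev_is_rev_conv by (metis mset_sorted_list_of_multiset)
  then obtain h where h: "h permutes {1..n}" "\<tau> = h \<circ> \<sigma> \<circ> inv' h"
    using conjugate_of_orbit_cards_eq[of "{1..n}" \<sigma> \<tau>] \<sigma> \<tau> by (auto simp: sym_group_carrier)
  show ?thesis
    by (rule that[of h]) (use h in \<open>simp_all add: sym_group_carrier sym_group_mult\<close>)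
qed

lemma cycle_type_in_partitions_of:
  assumes \<sigma>: "\<sigma> \<in> carrier (sym_group n)"
  shows "cycle_type n \<sigma> \<in> partitions_of n"
proof -
  have p: "\<sigma> permutes {1..n}" and p': "permutation \<sigma>"
    using \<sigma> permutes_imp_permutation by (auto simp: sym_group_carrier)
  let ?M = "image_mset card (mset_set (orbit \<sigma> ` {1..n}))"
  have mset: "mset (cycle_type n \<sigma>) = ?M" by (simp add: cycle_type_def)
  have "sorted_wrt (\<ge>) (cycle_type n \<sigma>)"
    using sorted_sorted_list_of_multiset[of ?M] by (simp add: cycle_type_def sorted_wrt_rev)
  moreover have "0 \<notin> set (cycle_type n \<sigma>)"
  proof -
    have nonzero: "card (orbit \<sigma> x) \<noteq> 0" for x
      using least_power_of_permutation(2)[OF p'] by (simp add: card_orbit_permutation[OF p'])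
    have "0 \<notin># ?M"
    proof
      assume "0 \<in># ?M"
      then obtain x where "card (orbit \<sigma> x) = 0" by auto
      then show False using nonzero by blast
    qed
    then show ?thesis by (metis mset set_mset_mset)
  qed
  moreover have "sum_list (cycle_type n \<sigma>) = n"
  proof -
    have "sum_list (cycle_type n \<sigma>) = sum card (orbit \<sigma> ` {1..n})"
      by (metis mset sum_mset_sum_list sum_unfold_sum_mset)
    also have "\<dots> = card (\<Union>(orbit \<sigma> ` {1..n}))"
    proof (rule card_Union_disjoint[symmetric])
      show "pairwise disjnt (orbit \<sigma> ` {1..n})"
        unfolding pairwise_def disjnt_def by (metis disjoint_iff imageE orbit_eq_of_mem[OF p'])
      show "finite A" if "A \<in> orbit \<sigma> ` {1..n}" for A
        using that finite_orbit[OF permutation_self_in_orbit[OF p']] by auto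
    qed
    also have "\<Union>(orbit \<sigma> ` {1..n}) = {1..n}"
      using permutes_orbit_subset[OF p] permutation_self_in_orbit[OF p'] by blast
    finally show ?thesis by simp
  qed
  ultimately show ?thesis by (simp add: partitions_of_def)
qed

text \<open>This removes the inverse from the orthogonality relations: characters of the symmetric
  group take the same value at a permutation and its inverse.\<close>

lemma cycle_type_inv:
  assumes "\<sigma> \<in> carrier (sym_group n)"
  shows "cycle_type n (inv\<^bsub>sym_group n\<^esub> \<sigma>) = cycle_type n \<sigma>"
proof -
  have "permutation \<sigma>" using assms by (rule sym_group_carrier')
  then show ?thesis using assms by (simp add: cycle_type_def orbit_inv_eq)
qed

section \<open>Orthonormality over partitions\<close>

text \<open>Turns row orthogonality of the character table into column orthogonality. The common
  index set for rows and columns is where it matters that labels and cycle types are both partitions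
  of n.\<close>

lemma square_matrix_left_inverse_imp_right_inverse:
  fixes a b :: "'i \<Rightarrow> 'i \<Rightarrow> complex"
  assumes I: "finite I"
    and inv: "\<And>x y. x \<in> I \<Longrightarrow> y \<in> I \<Longrightarrow> (\<Sum>z\<in>I. a x z * b z y) = (if x = y then 1 else 0)"
    and xy: "x \<in> I" "y \<in> I"
  shows "(\<Sum>z\<in>I. b x z * a z y) = (if x = y then 1 else 0)"
proof -
  define n where "n = card I"
  obtain e where e: "bij_betw e {..<n} I"
    using ex_bij_betw_nat_finite[OF I] by (auto simp: n_def atLeast0LessThan)
  have eI: "e i \<in> I" if "i < n" for i using e that by (auto simp: bij_betw_def)
  have e_eq: "e i = e j \<longleftrightarrow> i = j" if "i < n" "j < n" for i j
    using e that by (auto simp: bij_betw_def inj_on_def)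
  have sum_e: "(\<Sum>z\<in>I. f z) = (\<Sum>k<n. f (e k))" for f :: "'i \<Rightarrow> complex"
    using sum.reindex_bij_betw[OF e, of f] by simp
  define A where "A = mat n n (\<lambda>(i, j). a (e i) (e j))"
  define B where "B = mat n n (\<lambda>(i, j). b (e i) (e j))"
  have A: "A \<in> carrier_mat n n" and B: "B \<in> carrier_mat n n" by (simp_all add: A_def B_def)
  have "A * B = 1\<^sub>m n"
  proof (rule eq_matI)
    fix i j assume ij: "i < dim_row (1\<^sub>m n :: complex mat)" "j < dim_col (1\<^sub>m n :: complex mat)"
    then have "(A * B) $$ (i, j) = (\<Sum>k<n. a (e i) (e k) * b (e k) (e j))"
      by (simp add: mult_mat_entry[OF A B]) (simp add: A_def B_def)
    also have "\<dots> = (if e i = e j then 1 else 0)"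
      using inv[of "e i" "e j"] eI ij by (simp add: sum_e)
    finally show "(A * B) $$ (i, j) = 1\<^sub>m n $$ (i, j)" using ij by (simp add: e_eq)
  qed (use A B in auto)
  then have BA: "B * A = 1\<^sub>m n" by (rule mat_mult_left_right_inverse[OF A B])
  obtain i j where ij: "i < n" "x = e i" "j < n" "y = e j" using xy e by (auto simp: bij_betw_def)
  have "(\<Sum>z\<in>I. b x z * a z y) = (B * A) $$ (i, j)"
    using ij by (simp add: mult_mat_entry[OF B A] sum_e) (simp add: A_def B_def)
  also have "\<dots> = (if x = y then 1 else 0)" using ij by (simp add: BA e_eq)
  finally show ?thesis .
qed

lemma card_sym_group: "card (carrier (sym_group n)) = fact n"
  by (simp add: sym_group_def card_permutations)

lemma finite_sym_group: "finite (carrier (sym_group n))"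
  by (simp add: sym_group_def finite_permutations)

lemma character_eq_of_cycle_type_eq:
  assumes \<chi>: "is_character (sym_group n) \<chi>" and \<sigma>: "\<sigma> \<in> carrier (sym_group n)" and \<tau>: "\<tau> \<in> carrier (sym_group n)"
    and eq: "cycle_type n \<sigma> = cycle_type n \<tau>"
  shows "\<chi> \<sigma> = \<chi> \<tau>"
proof -
  obtain h where "h \<in> carrier (sym_group n)"
    "\<tau> = h \<otimes>\<^bsub>sym_group n\<^esub> \<sigma> \<otimes>\<^bsub>sym_group n\<^esub> inv\<^bsub>sym_group n\<^esub> h"
    using cycle_type_conjugate[OF \<sigma> \<tau> eq] .
  then show ?thesis using character_conjugate[OF sym_group_is_group \<chi> \<sigma>] by metis
qed

lemma irreducible_characters_of_labels_orthonormal: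
  assumes \<chi>: "\<And>\<alpha>. \<alpha> \<in> partitions_of n \<Longrightarrow> is_irreducible_character_of_label n \<alpha> (\<chi> \<alpha>)"
    and \<alpha>: "\<alpha> \<in> partitions_of n" and \<beta>: "\<beta> \<in> partitions_of n"
  shows "(\<Sum>\<sigma>\<in>carrier (sym_group n). \<chi> \<alpha> \<sigma> * \<chi> \<beta> \<sigma>) = (if \<alpha> = \<beta> then fact n else 0)"
proof -
  let ?G = "sym_group n"
  have irr: "is_irreducible_character ?G (\<chi> \<alpha>)" "is_irreducible_character ?G (\<chi> \<beta>)"
    and frob: "frobenius_characteristic n (\<chi> \<alpha>) = schur_function \<alpha>" "frobenius_characteristic n (\<chi> \<beta>) = schur_function \<beta>"
    using \<chi>[OF \<alpha>] \<chi>[OF \<beta>] by (auto simp: is_irreducible_character_of_label_def)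
  have inv: "\<chi> \<beta> (inv\<^bsub>?G\<^esub> \<sigma>) = \<chi> \<beta> \<sigma>" if \<sigma>: "\<sigma> \<in> carrier ?G" for \<sigma>
    using group.inv_closed[OF sym_group_is_group \<sigma>]
    by (rule character_eq_of_cycle_type_eq[OF irreducible_character_is_character[OF irr(2)] _ \<sigma> cycle_type_inv[OF \<sigma>]])
  have sum: "(\<Sum>\<sigma>\<in>carrier ?G. \<chi> \<alpha> \<sigma> * \<chi> \<beta> \<sigma>) = (\<Sum>\<sigma>\<in>carrier ?G. \<chi> \<alpha> \<sigma> * \<chi> \<beta> (inv\<^bsub>?G\<^esub> \<sigma>))"
    by (intro sum.cong refl) (simp only: inv)
  show ?thesis
  proof (cases "\<alpha> = \<beta>")
    case True
    have "(\<Sum>\<sigma>\<in>carrier ?G. \<chi> \<alpha> \<sigma> * \<chi> \<beta> \<sigma>) = of_nat (card (carrier ?G))"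
      unfolding sum unfolding True by (rule irreducible_character_norm[OF sym_group_is_group irr(2)])
    then show ?thesis using True by (simp add: card_sym_group)
  next
    case False
    have "\<exists>\<tau>. \<tau> \<in> carrier ?G \<and> \<chi> \<alpha> \<tau> \<noteq> \<chi> \<beta> \<tau>"
    proof (rule ccontr)
      assume "\<not> ?thesis"
      then have "frobenius_characteristic n (\<chi> \<alpha>) = frobenius_characteristic n (\<chi> \<beta>)"
        by (auto simp: frobenius_characteristic_def fun_eq_iff)
      then show False using schur_function_inject[OF \<alpha> \<beta>] frob False by simp
    qed
    then obtain \<tau> where \<tau>: "\<tau> \<in> carrier ?G" "\<chi> \<alpha> \<tau> \<noteq> \<chi> \<beta> \<tau>" by blast
    have "(\<Sum>\<sigma>\<in>carrier ?G. \<chi> \<alpha> \<sigma> * \<chi> \<beta> \<sigma>) = 0"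
      unfolding sum by (rule irreducible_characters_orthogonal[of ?G "\<chi> \<alpha>" "\<chi> \<beta>" \<tau>, OF sym_group_is_group irr \<tau>])
    then show ?thesis using False by simp
  qed
qed

section \<open>Inverting the character table\<close>

theorem theorem1p3:
  fixes k l n :: nat
    and \<chi> :: "nat list \<Rightarrow> (nat \<Rightarrow> nat) \<Rightarrow> complex"
  assumes "\<And>\<alpha>. \<alpha> \<in> partitions_of n \<Longrightarrow> is_irreducible_character_of_label n \<alpha> (\<chi> \<alpha>)"
  shows "is_character (sym_group n) (Lambda_char \<chi> k l n) \<and>
         (\<forall>\<nu> \<in> partitions_of n. \<forall>\<sigma> \<in> carrier (sym_group n). cycle_type n \<sigma> = \<nu> \<longrightarrow>
            Lambda_char \<chi> k l n \<sigma> =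
              (\<Prod>i=1..length \<nu>. of_nat k + (-1) ^ (\<nu> ! (i - 1) - 1) * of_nat l))"
proof (intro conjI ballI impI)
  let ?G = "sym_group n"
  have char: "is_character ?G (\<chi> \<alpha>)" if "\<alpha> \<in> partitions_of n" for \<alpha>
    using assms[OF that] irreducible_character_is_character by (auto simp: is_irreducible_character_of_label_def)
  show "is_character ?G (Lambda_char \<chi> k l n)"
    unfolding Lambda_char_def
    by (intro is_character_sum is_character_of_nat_mult sym_group_is_group finite_partitions_of char)
  define q :: "nat list \<Rightarrow> complex" where "q \<nu> = (\<Prod>r\<leftarrow>\<nu>. of_nat k - (- 1) ^ r * of_nat l)" for \<nu>
  \<comment> \<open>\<open>X \<alpha> \<nu>\<close> is junk if no permutation has cycle type \<open>\<nu>\<close>; such \<open>\<nu>\<close> get weight 0 because \<open>C \<nu> = {}\<close>.\<close>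
  define X where "X \<alpha> \<nu> = \<chi> \<alpha> (SOME \<sigma>. \<sigma> \<in> carrier ?G \<and> cycle_type n \<sigma> = \<nu>)" for \<alpha> \<nu>
  have X: "X \<alpha> (cycle_type n \<sigma>) = \<chi> \<alpha> \<sigma>" if "\<alpha> \<in> partitions_of n" "\<sigma> \<in> carrier ?G" for \<alpha> \<sigma>
  proof -
    have "\<exists>\<tau>. \<tau> \<in> carrier ?G \<and> cycle_type n \<tau> = cycle_type n \<sigma>" using that by blast
    from someI_ex[OF this] show ?thesis
      unfolding X_def using character_eq_of_cycle_type_eq[OF char[OF that(1)]] that(2) by blast
  qed
  define C where "C \<nu> = {\<sigma> \<in> carrier ?G. cycle_type n \<sigma> = \<nu>}" for \<nu>
  have sum_classes: "(\<Sum>\<sigma>\<in>carrier ?G. f (cycle_type n \<sigma>)) = (\<Sum>\<nu>\<in>partitions_of n. of_nat (card (C \<nu>)) * f \<nu>)"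
    for f :: "nat list \<Rightarrow> complex"
  proof -
    have "(\<Sum>\<nu>\<in>partitions_of n. of_nat (card (C \<nu>)) * f \<nu>) = (\<Sum>\<nu>\<in>partitions_of n. \<Sum>\<sigma>\<in>C \<nu>. f (cycle_type n \<sigma>))"
      by (simp add: C_def)
    also have "\<dots> = (\<Sum>\<sigma>\<in>carrier ?G. f (cycle_type n \<sigma>))"
      unfolding C_def
      by (rule sum.group[OF finite_sym_group finite_partitions_of]) (use cycle_type_in_partitions_of in blast)
    finally show ?thesis by simp
  qed
  \<comment> \<open>Grouped by cycle type, orthonormality says that this matrix is a right inverse
    of X. The same matrix also expresses the tableau counts in terms of q, so the other inverse
    relation, \<open>orth\<close>, isolates a single q.\<close>
  define b where "b \<nu> \<alpha> = of_nat (card (C \<nu>)) * X \<alpha> \<nu> / fact n" for \<nu> \<alpha>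
  have orth: "(\<Sum>\<alpha>\<in>partitions_of n. b \<nu> \<alpha> * X \<alpha> \<mu>) = (if \<nu> = \<mu> then 1 else 0)"
    if "\<nu> \<in> partitions_of n" "\<mu> \<in> partitions_of n" for \<nu> \<mu>
  proof (rule square_matrix_left_inverse_imp_right_inverse[OF finite_partitions_of _ that])
    fix \<alpha> \<beta> assume ab: "\<alpha> \<in> partitions_of n" "\<beta> \<in> partitions_of n"
    have "(\<Sum>\<nu>\<in>partitions_of n. X \<alpha> \<nu> * b \<nu> \<beta>) = (\<Sum>\<nu>\<in>partitions_of n. of_nat (card (C \<nu>)) * (X \<alpha> \<nu> * X \<beta> \<nu>)) / fact n"
      by (simp add: b_def sum_divide_distrib mult_ac)
    also have "(\<Sum>\<nu>\<in>partitions_of n. of_nat (card (C \<nu>)) * (X \<alpha> \<nu> * X \<beta> \<nu>)) = (\<Sum>\<sigma>\<in>carrier ?G. \<chi> \<alpha> \<sigma> * \<chi> \<beta> \<sigma>)"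
      unfolding sum_classes[of "\<lambda>\<nu>. X \<alpha> \<nu> * X \<beta> \<nu>", symmetric] using ab by (simp add: X)
    also have "\<dots> = (if \<alpha> = \<beta> then fact n else 0)"
      by (rule irreducible_characters_of_labels_orthonormal[OF assms ab])
    finally show "(\<Sum>\<nu>\<in>partitions_of n. X \<alpha> \<nu> * b \<nu> \<beta>) = (if \<alpha> = \<beta> then 1 else 0)" by simp
  qed
  have num: "of_nat (num_tableaux k l \<alpha>) = (\<Sum>\<nu>\<in>partitions_of n. b \<nu> \<alpha> * q \<nu>)" if \<alpha>: "\<alpha> \<in> partitions_of n" for \<alpha>
  proof -
    have "schur_function \<alpha> N x = (\<Sum>\<sigma>\<in>carrier ?G. \<chi> \<alpha> \<sigma> / fact n * power_sum (cycle_type n \<sigma>) N x)" for N x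
    proof -
      have "schur_function \<alpha> N x = frobenius_characteristic n (\<chi> \<alpha>) N x"
        using assms[OF \<alpha>] by (simp add: is_irreducible_character_of_label_def)
      then show ?thesis by (simp add: frobenius_characteristic_def sum_divide_distrib)
    qed
    then have "of_nat (num_tableaux k l \<alpha>) = (\<Sum>\<sigma>\<in>carrier ?G. \<chi> \<alpha> \<sigma> / fact n * q (cycle_type n \<sigma>))"
      unfolding q_def by (rule num_tableaux_power_sum_expansion[OF \<alpha>])
    also have "\<dots> = (\<Sum>\<sigma>\<in>carrier ?G. X \<alpha> (cycle_type n \<sigma>) / fact n * q (cycle_type n \<sigma>))"
      by (intro sum.cong refl) (simp add: X \<alpha>)
    also have "\<dots> = (\<Sum>\<nu>\<in>partitions_of n. b \<nu> \<alpha> * q \<nu>)"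
      unfolding sum_classes[of "\<lambda>\<nu>. X \<alpha> \<nu> / fact n * q \<nu>"] by (simp add: b_def mult.assoc)
    finally show ?thesis .
  qed
  fix \<nu> \<sigma> assume \<nu>: "\<nu> \<in> partitions_of n" and \<sigma>: "\<sigma> \<in> carrier ?G" "cycle_type n \<sigma> = \<nu>"
  have "Lambda_char \<chi> k l n \<sigma> = (\<Sum>\<alpha>\<in>partitions_of n. (\<Sum>\<mu>\<in>partitions_of n. b \<mu> \<alpha> * q \<mu>) * X \<alpha> \<nu>)"
    unfolding Lambda_char_def using X[OF _ \<sigma>(1)] \<sigma>(2) by (intro sum.cong refl) (simp add: num)
  also have "\<dots> = (\<Sum>\<mu>\<in>partitions_of n. q \<mu> * (\<Sum>\<alpha>\<in>partitions_of n. b \<mu> \<alpha> * X \<alpha> \<nu>))"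
    unfolding sum_distrib_left sum_distrib_right by (subst sum.swap) (simp add: mult_ac)
  also have "\<dots> = (\<Sum>\<mu>\<in>partitions_of n. if \<mu> = \<nu> then q \<mu> else 0)"
    by (intro sum.cong refl) (simp add: orth \<nu>)
  also have "\<dots> = q \<nu>" using \<nu> by (simp add: finite_partitions_of)
  also have "\<dots> = (\<Prod>i<length \<nu>. of_nat k - (- 1) ^ (\<nu> ! i) * of_nat l)"
    by (simp add: q_def prod.list_conv_set_nth atLeast0LessThan)
  also have "\<dots> = (\<Prod>i=1..length \<nu>. of_nat k + (-1) ^ (\<nu> ! (i - 1) - 1) * of_nat l)"
  proof (rule prod.reindex_bij_witness[of _ "\<lambda>i. i - 1" Suc])
    fix i assume "i \<in> {..<length \<nu>}"
    then have "\<nu> ! i \<in> set \<nu>" by simp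
    moreover have "0 \<notin> set \<nu>" using \<nu> by (simp add: partitions_of_def)
    ultimately have "\<nu> ! i \<noteq> 0" by metis
    \<comment> \<open>Positivity of the part makes the truncated subtraction in the exponent a true
      predecessor, which absorbs the minus sign in front of the power of -1.\<close>
    then obtain r where "\<nu> ! i = Suc r" using not0_implies_Suc by blast
    then show "of_nat k + (-1) ^ (\<nu> ! (Suc i - 1) - 1) * of_nat l = (of_nat k - (- 1) ^ (\<nu> ! i) * of_nat l :: complex)"
      by simp
  qed auto
  finally show "Lambda_char \<chi> k l n \<sigma> = (\<Prod>i=1..length \<nu>. of_nat k + (-1) ^ (\<nu> ! (i - 1) - 1) * of_nat l)" .
qed

end
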